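(* Let $\alpha>0$, let $H$ and $F$ be probability distributions on a sample space $\mathcal X$, and let $X_1,X_2,\dots$ be i.i.d. with distribution $F$. Let $P_m^*\sim DP(\alpha_m^*H_m^* )$ be the posterior Dirichlet process given $X_1,\dots,X_m$, where $\alpha_m^*=\alpha+m$ and $H_m^*=\frac{\alpha}{\alpha+m}H+\frac{1}{\alpha+m}\sum_{i=1}^m\delta_{X_i}$. Let $\{A_1,\dots,A_k\}$ ($k\ge2$) be a finite measurable partition of $\mathcal X$ with $F(A_i)>0$ for all $i$, and define $$\mathcal D(P_m^*,H_m^* )=\alpha_m^*\sum_{i=1}^k\frac{(P_m^*(A_i)-H_m^*(A_i))^2}{H_m^*(A_i)},\qquad D_{KL}(P_m^*\|H_m^* )=\sum_{i=1}^kP_m^*(A_i)\log\frac{P_m^*(A_i)}{H_m^*(A_i)}.$$ Then, for almost every realization of $X_1,X_2,\dots$, conditionally on $X_1,\dots,X_m$, as $m\to\infty$, $$\mathcal D(P_m^*,H_m^* )\xrightarrow{d}\chi^2_{(k-1)},$$ and $2\alpha_m^*D_{KL}(P_m^*\|H_m^* )-\mathcal D(P_m^*,H_m^* )\to0$ in probability, so that $2\alpha_m^*D_{KL}(P_m^*\|H_m^* )\xrightarrow{d}\chi^2_{(k-1)}$ as well.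
   Context: $DP(\alpha H)$ denotes a Dirichlet process with concentration $\alpha>0$ and base distribution $H$: a random probability measure $P$ such that for every finite measurable partition $\{A_1,\dots,A_k\}$, $(P(A_1),\dots,P(A_k))\sim\mathrm{Dir}(\alpha H(A_1),\dots,\alpha H(A_k))$. $\chi^2_{(k-1)}$ is the chi-squared distribution with $k-1$ degrees of freedom. *)

theory Defs
  imports "HOL-Probability.Probability"
begin

definition gamma_meas :: "real \<Rightarrow> real measure" where
  "gamma_meas a = (if a = 0 then return borel 0 else
     density lborel (\<lambda>x. ennreal (if 0 < x then x powr (a - 1) * exp (- x) / Gamma a else 0)))"

definition dirichlet :: "nat \<Rightarrow> (nat \<Rightarrow> real) \<Rightarrow> (nat \<Rightarrow> real) measure" where
  "dirichlet k a = distr (PiM {..<k} (\<lambda>i. gamma_meas (a i))) (PiM {..<k} (\<lambda>_. borel))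
     (\<lambda>g. \<lambda>i\<in>{..<k}. g i / (\<Sum>j<k. g j))"

definition chi_sq :: "real \<Rightarrow> real measure" where
  "chi_sq nu = density lborel (\<lambda>x. ennreal (if 0 < x then
      x powr (nu / 2 - 1) * exp (- x / 2) / (2 powr (nu / 2) * Gamma (nu / 2)) else 0))"

definition meas_partition :: "'a measure \<Rightarrow> nat \<Rightarrow> (nat \<Rightarrow> 'a set) \<Rightarrow> bool" where
  "meas_partition M k A \<longleftrightarrow> (\<forall>i<k. A i \<in> sets M) \<and> disjoint_family_on A {..<k}
     \<and> (\<Union>i<k. A i) = space M"

definition is_DP :: "'w measure \<Rightarrow> 'a measure \<Rightarrow> ('w \<Rightarrow> 'a measure) \<Rightarrow> real \<Rightarrow> 'a measure \<Rightarrow> bool" where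
  "is_DP Q M P alpha H \<longleftrightarrow> prob_space Q \<and> P \<in> measurable Q (prob_algebra M) \<and>
     (\<forall>k A. meas_partition M k A \<longrightarrow>
        distr Q (PiM {..<k} (\<lambda>_. borel)) (\<lambda>w. \<lambda>i\<in>{..<k}. measure (P w) (A i))
          = dirichlet k (\<lambda>i. alpha * measure H (A i)))"

definition post_base :: "'a measure \<Rightarrow> real \<Rightarrow> 'a measure \<Rightarrow> (nat \<Rightarrow> 'a) \<Rightarrow> nat \<Rightarrow> 'a measure" where
  "post_base M alpha H x m = measure_of (space M) (sets M)
     (\<lambda>B. ennreal ((alpha * measure H B + (\<Sum>i<m. indicator B (x i))) / (alpha + real m)))"

definition chi_stat :: "real \<Rightarrow> nat \<Rightarrow> (nat \<Rightarrow> 'a set) \<Rightarrow> 'a measure \<Rightarrow> 'a measure \<Rightarrow> real" where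
  "chi_stat a k A P H = a * (\<Sum>i<k. (measure P (A i) - measure H (A i))^2 / measure H (A i))"

definition KL_part :: "nat \<Rightarrow> (nat \<Rightarrow> 'a set) \<Rightarrow> 'a measure \<Rightarrow> 'a measure \<Rightarrow> real" where
  "KL_part k A P H = (\<Sum>i<k. measure P (A i) * ln (measure P (A i) / measure H (A i)))"

definition conv_prob_zero :: "(nat \<Rightarrow> 'w measure) \<Rightarrow> (nat \<Rightarrow> 'w \<Rightarrow> real) \<Rightarrow> bool" where
  "conv_prob_zero Q Y \<longleftrightarrow> (\<forall>e>0. (\<lambda>m. measure (Q m) {w \<in> space (Q m). e < \<bar>Y m w\<bar>}) \<longlonglongrightarrow> 0)"

end

theory Submission
  imports Defs "HOL-Real_Asymp.Real_Asymp"
begin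

text \<open>
  Write \<open>b\<^sub>i\<close> for the posterior weight of the cell \<open>A\<^sub>i\<close>. The vector of cell probabilities is
  \<open>G\<^sub>i / (G\<^sub>1 + \<dots> + G\<^sub>k)\<close> with independent \<open>G\<^sub>i = b\<^sub>i + sqrt b\<^sub>i * z\<^sub>i\<close> of law \<open>Gamma(b\<^sub>i)\<close>. As \<open>b\<^sub>i\<close> tends
  to infinity the density of \<open>z\<^sub>i\<close> converges to the standard normal density under an exponential
  majorant, so the joint law of \<open>z\<close> converges in total variation to \<open>N(0, I)\<close>, and every probability
  may be computed for a fixed Gaussian vector \<open>z\<close>. There the chi-square statistic differs from
  \<open>|z|\<^sup>2 - (u \<bullet> z)\<^sup>2\<close>, \<open>u\<^sub>i = sqrt (b\<^sub>i / (b\<^sub>1 + \<dots> + b\<^sub>k))\<close>, by a term that vanishes pointwise; this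
  quadratic form has exactly the chi-square law with \<open>k - 1\<close> degrees of freedom, whatever the unit
  vector \<open>u\<close>. A Taylor expansion shows that the Kullback-Leibler statistic is also pointwise
  asymptotically equal to it. Only \<open>b\<^sub>i \<longlonglongrightarrow> \<infinity>\<close> is needed, so of the sample it matters
  only that almost surely each cell is visited infinitely often.
\<close>

section \<open>Chi-square and gamma laws\<close>

text \<open>The unit vector \<open>u\<close> moves with \<open>m\<close>, and so do the statistics
  and the events to be measured, so there is no single continuous map to apply to a weak limit of
  \<open>z\<close>. Total variation gets around this: its error bound is uniform over all events,
  hence valid along a sequence of events that changes with \<open>m\<close>. On the Gaussian side
  the comparison form has one and the same law for every \<open>m\<close>, so a Slutsky argument
  against a constant law applies although the form itself moves; its boundedness in \<open>m\<close>
  at each fixed \<open>z\<close> turns a multiplicative error tending to 1 into an additive error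
  tending to 0. The price is that a Gaussian \<open>z\<close> may yield negative "probabilities" and
  meaningless logarithms for small \<open>m\<close>; this is harmless, since for each fixed
  \<open>z\<close> only large \<open>m\<close> count. Stirling's formula for \<open>Gamma\<close>
  comes out on the way: the normalising constant of the standardised gamma density is the reciprocal
  of an integral to which dominated convergence applies.\<close>

abbreviation gamma_density :: "real \<Rightarrow> real \<Rightarrow> real" where
  "gamma_density a x \<equiv> (if 0 < x then x powr (a - 1) * exp (- x) / Gamma a else 0)"

abbreviation chi_sq_density :: "real \<Rightarrow> real \<Rightarrow> real" where
  "chi_sq_density nu x \<equiv>
     (if 0 < x then x powr (nu / 2 - 1) * exp (- x / 2) / (2 powr (nu / 2) * Gamma (nu / 2)) else 0)"

abbreviation std_normal :: "real measure" where
  "std_normal \<equiv> density lborel (\<lambda>x. ennreal (std_normal_density x))"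

lemma nn_integral_gamma_density:
  assumes "0 < a"
  shows "(\<integral>\<^sup>+x. ennreal (gamma_density a x) \<partial>lborel) = 1"
proof -
  have G: "0 < Gamma a" using assms by (rule Gamma_real_pos)
  have "(\<integral>\<^sup>+x. ennreal (gamma_density a x) \<partial>lborel) =
      (\<integral>\<^sup>+x. ennreal (indicator {0..} x * x powr (a - 1) / exp x) * ennreal (1 / Gamma a) \<partial>lborel)"
    using G by (intro nn_integral_cong) (auto simp: indicator_def exp_minus field_simps ennreal_mult'[symmetric])
  also have "\<dots> = ennreal (Gamma a) * ennreal (1 / Gamma a)"
    using Gamma_conv_nn_integral_real[OF assms] by (subst nn_integral_multc) auto
  also have "\<dots> = 1"
    using G by (simp add: ennreal_mult'[symmetric])
  finally show ?thesis .
qed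

lemma prob_space_gamma_meas:
  assumes "0 < a"
  shows "prob_space (gamma_meas a)"
  using nn_integral_gamma_density[OF assms] assms
  by (intro prob_spaceI) (simp add: gamma_meas_def emeasure_density cong: if_cong)

lemma prob_space_chi_sq:
  assumes "0 < nu"
  shows "prob_space (chi_sq nu)"
proof (rule prob_spaceI)
  have G: "0 < Gamma (nu / 2)" using assms by (intro Gamma_real_pos) auto
  have "emeasure (chi_sq nu) (space (chi_sq nu)) = (\<integral>\<^sup>+x. ennreal (chi_sq_density nu x) \<partial>lborel)"
    by (simp add: chi_sq_def emeasure_density cong: if_cong)
  \<comment> \<open>Halving the variable turns the chi-square density into the gamma density of
    shape \<open>nu / 2\<close>.\<close>
  also have "\<dots> = 2 * (\<integral>\<^sup>+x. ennreal (chi_sq_density nu (0 + 2 * x)) \<partial>lborel)"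
    by (subst nn_integral_real_affine[where c=2 and t=0]) auto
  also have "\<dots> = (\<integral>\<^sup>+x. 2 * ennreal (chi_sq_density nu (0 + 2 * x)) \<partial>lborel)"
    by (rule nn_integral_cmult[symmetric]) auto
  also have "\<dots> = (\<integral>\<^sup>+x. ennreal (gamma_density (nu / 2) x) \<partial>lborel)"
  proof (intro nn_integral_cong)
    fix x :: real
    define q :: real where "q = 2 powr (nu / 2 - 1)"
    have q: "2 powr (nu / 2) = 2 * q" "0 < q"
      by (simp_all add: q_def powr_diff)
    have "(2 * x) powr (nu / 2 - 1) = q * x powr (nu / 2 - 1)" if "0 < x"
      using that by (simp add: q_def powr_mult)
    then have "2 * chi_sq_density nu (0 + 2 * x) = gamma_density (nu / 2) x"
      using G q(2) unfolding q(1) by auto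
    moreover have "2 * ennreal (chi_sq_density nu (0 + 2 * x)) = ennreal (2 * chi_sq_density nu (0 + 2 * x))"
      using G by (subst ennreal_mult') auto
    ultimately show "2 * ennreal (chi_sq_density nu (0 + 2 * x)) = ennreal (gamma_density (nu / 2) x)"
      by simp
  qed
  also have "\<dots> = 1"
    using assms by (intro nn_integral_gamma_density) auto
  finally show "emeasure (chi_sq nu) (space (chi_sq nu)) = 1" .
qed

lemma sets_chi_sq [simp, measurable_cong]: "sets (chi_sq nu) = sets borel"
  by (simp add: chi_sq_def)

lemma real_distribution_chi_sq:
  "0 < nu \<Longrightarrow> real_distribution (chi_sq nu)"
  by (simp add: real_distribution_def real_distribution_axioms_def prob_space_chi_sq)

text \<open>For \<open>x > 0\<close> the substitution \<open>y = x * t\<close> separates the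
  variables: the powers of \<open>x\<close> and the exponentials combine to those of the density
  with parameter \<open>a + b\<close>, and what remains in \<open>t\<close> is a Beta integral whose
  value corrects the Gamma factors.\<close>

lemma convolution_chi_sq:
  assumes a: "0 < a" and b: "0 < b"
  shows "chi_sq a \<star> chi_sq b = chi_sq (a + b)"
proof -
  interpret A: prob_space "chi_sq a" by (rule prob_space_chi_sq) fact
  interpret B: prob_space "chi_sq b" by (rule prob_space_chi_sq) fact
  have Ga: "0 < Gamma (a / 2)" and Gb: "0 < Gamma (b / 2)" and Gab: "0 < Gamma ((a + b) / 2)"
    using assms by (auto intro: Gamma_real_pos)
  have Beta: "(\<integral>\<^sup>+t. ennreal (indicator {0..1} t * ((1 - t) powr (a/2 - 1) * t powr (b/2 - 1))) \<partial>lborel)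
       = ennreal (Beta (b/2) (a/2))"
    using nn_integral_has_integral_lebesgue[OF _ has_integral_Beta_real[of "b/2" "a/2"]] assms
    by (simp add: mult.commute)
  define f g h where "f = (\<lambda>x. chi_sq_density a x)" and "g = (\<lambda>x. chi_sq_density b x)"
    and "h = (\<lambda>x. chi_sq_density (a + b) x)"
  have fgh: "chi_sq a = density lborel (\<lambda>x. ennreal (f x))" "chi_sq b = density lborel (\<lambda>x. ennreal (g x))"
    "chi_sq (a + b) = density lborel (\<lambda>x. ennreal (h x))"
    by (simp_all only: chi_sq_def f_def g_def h_def)
  have [measurable]: "f \<in> borel_measurable borel" "g \<in> borel_measurable borel" "h \<in> borel_measurable borel"
    unfolding f_def g_def h_def by measurable
  have pos: "0 \<le> f x" "0 \<le> g x" for x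
    using Ga Gb by (auto simp: f_def g_def)
  have zero: "f x = 0" "g x = 0" "h x = 0" if "x \<le> 0" for x
    using that by (auto simp: f_def g_def h_def)
  have "chi_sq a \<star> chi_sq b = density lborel (\<lambda>x. \<integral>\<^sup>+y. ennreal (f (x - y)) * ennreal (g y) \<partial>lborel)"
    unfolding fgh
    by (intro convolution_density) (auto simp: fgh[symmetric] A.finite_measure_axioms B.finite_measure_axioms)
  also have "\<dots> = density lborel (\<lambda>x. ennreal (h x))"
  proof (intro density_cong AE_I2)
    fix x :: real
    show "(\<integral>\<^sup>+y. ennreal (f (x - y)) * ennreal (g y) \<partial>lborel) = ennreal (h x)" (is "?L = _")
    proof (cases "0 < x")
      case False
      then have "(\<lambda>y. ennreal (f (x - y)) * ennreal (g y)) = (\<lambda>y. 0)"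
        by (intro ext, rename_tac y, case_tac "0 < y") (simp_all add: zero)
      then show ?thesis using False by (simp only:) (simp add: zero)
    next
      case True
      define c where "c = x powr ((a+b)/2 - 1) * exp (- x / 2) / 
         (2 powr ((a + b) / 2) * Gamma (a / 2) * Gamma (b / 2))"
      have c: "0 \<le> c" using Ga Gb by (auto simp: c_def)
      define \<beta> where "\<beta> = (\<lambda>t::real. (1 - t) powr (a/2 - 1) * t powr (b/2 - 1))"
      have [measurable]: "\<beta> \<in> borel_measurable borel"
        unfolding \<beta>_def by measurable
      \<comment> \<open>Outside the unit interval one of the arguments \<open>x - x * t\<close> and
        \<open>x * t\<close> is negative, so both sides vanish. The two endpoints are left out as a
        null set.\<close>
      have *: "x * (f (x - x * t) * g (x * t)) = c * (indicator {0..1} t * \<beta> t)"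
        if t: "t \<noteq> 0" "t \<noteq> 1" for t
      proof (cases "0 < t \<and> t < 1")
        case False
        then have "t \<notin> {0..1}"
          using t by auto
        moreover have "x * t \<le> 0 \<or> x * 1 \<le> x * t"
          using True False by (metis linorder_not_le mult_le_0_iff mult_le_cancel_left_pos order_less_imp_le)
        ultimately show ?thesis using zero by auto
      next
        case t: True
        have 1: "x - x * t = x * (1 - t)" "0 < x * (1 - t)" "0 < x * t"
          using t True by (auto simp: algebra_simps)
        have 2: "x * (x powr (a / 2 - 1) * x powr (b / 2 - 1)) = x powr ((a + b) / 2 - 1)"
          using True by (simp add: powr_diff add_divide_distrib powr_add)
        have 3: "exp (- (x * (1 - t)) / 2) * exp (- (x * t) / 2) = exp (- x / 2)"
          by (simp add: exp_add[symmetric] field_simps)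
        have 4: "2 powr ((a + b) / 2) = 2 powr (a / 2) * 2 powr (b / 2 :: real)"
          by (simp add: add_divide_distrib powr_add)
        have 5: "f (x * (1 - t)) = x powr (a / 2 - 1) * (1 - t) powr (a/2 - 1) * exp (- (x * (1 - t)) / 2)
             / (2 powr (a / 2) * Gamma (a / 2))"
          using 1(2) True t by (simp only: f_def if_True powr_mult)
        have 6: "g (x * t) = x powr (b / 2 - 1) * t powr (b/2 - 1) * exp (- (x * t) / 2)
             / (2 powr (b / 2) * Gamma (b / 2))"
          using 1(3) True t by (simp only: g_def if_True powr_mult)
        have "x * (f (x * (1 - t)) * g (x * t)) =
          (x * (x powr (a / 2 - 1) * x powr (b / 2 - 1))) * (exp (- (x * (1 - t)) / 2) * exp (- (x * t) / 2))
           * \<beta> t / (2 powr ((a + b) / 2) * Gamma (a / 2) * Gamma (b / 2))"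
          unfolding 4 5 6 \<beta>_def by (simp only: times_divide_times_eq times_divide_eq_right times_divide_eq_left divide_divide_eq_left mult_ac)
        also have "\<dots> = c * \<beta> t"
          unfolding 2 3 c_def by (simp only: times_divide_eq_left times_divide_eq_right mult_ac)
        finally show ?thesis
          unfolding 1(1) using t by simp
      qed
      have "?L = x * (\<integral>\<^sup>+t. ennreal (f (x - x * t)) * ennreal (g (x * t)) \<partial>lborel)"
        using True by (subst nn_integral_real_affine[where c=x and t=0]) auto
      also have "\<dots> = (\<integral>\<^sup>+t. ennreal x * (ennreal (f (x - x * t)) * ennreal (g (x * t))) \<partial>lborel)"
        by (rule nn_integral_cmult[symmetric]) auto
      also have "\<dots> = (\<integral>\<^sup>+t. ennreal c * ennreal (indicator {0..1} t * \<beta> t) \<partial>lborel)"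
      proof (intro nn_integral_cong_AE, use AE_lborel_singleton[of 0] AE_lborel_singleton[of 1] in eventually_elim)
        case (elim t)
        have "ennreal x * (ennreal (f (x - x * t)) * ennreal (g (x * t))) = ennreal (x * (f (x - x * t) * g (x * t)))"
          using True pos by (simp add: ennreal_mult)
        then show ?case
          unfolding *[OF elim] using c by (simp add: ennreal_mult')
      qed
      also have "\<dots> = ennreal c * ennreal (Beta (b/2) (a/2))"
        using Beta by (subst nn_integral_cmult) (auto simp: \<beta>_def)
      also have "\<dots> = ennreal (c * Beta (b/2) (a/2))"
        using c by (simp add: ennreal_mult')
      also have "c * Beta (b/2) (a/2) = h x"
      proof -
        have "Beta (b/2) (a/2) = Gamma (a/2) * Gamma (b/2) / Gamma ((a + b) / 2)"
          by (simp only: Beta_def add_divide_distrib mult_ac add_ac)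
        then show ?thesis
          using Ga Gb True by (simp add: c_def h_def)
      qed
      finally show ?thesis .
    qed
  qed measurable
  finally show ?thesis by (simp only: fgh)
qed

text \<open>The distribution functions are compared. For \<open>t = r^2 > 0\<close> the symmetry of
  the normal density folds the interval from \<open>-r\<close> to \<open>r\<close> onto its right
  half, where squaring is monotone and can be substituted.\<close>

lemma distr_std_normal_power2: "distr std_normal borel (\<lambda>x. x\<^sup>2) = chi_sq 1"
proof (rule cdf_unique)
  interpret N: prob_space std_normal
    by (rule prob_space_normal_density) simp
  show D: "real_distribution (distr std_normal borel (\<lambda>x. x\<^sup>2))"
    by (rule N.real_distribution_distr) simp
  show "real_distribution (chi_sq 1)"
    by (rule real_distribution_chi_sq) simp
  define h where "h = (\<lambda>x. chi_sq_density 1 x)"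
  define \<phi> where "\<phi> = std_normal_density"
  have [measurable]: "h \<in> borel_measurable borel" "\<phi> \<in> borel_measurable borel"
    unfolding h_def \<phi>_def by measurable
  have even: "\<phi> (- x) = \<phi> x" for x
    by (simp add: \<phi>_def std_normal_density_def)
  have \<phi>0: "0 \<le> \<phi> x" for x
    by (simp add: \<phi>_def)
  have h0: "h x = 0" if "x \<le> 0" for x
    using that by (simp add: h_def)
  \<comment> \<open>The change-of-variables identity for squaring; the factor 2 counts the two
    square roots, and the constants match because \<open>Gamma (1/2) = sqrt pi\<close>.\<close>
  have subst: "2 * \<phi> x = h (x\<^sup>2) * (2 * x)" if "0 < x" for x
  proof -
    have "(x\<^sup>2) powr - (1/2) = 1 / x"
      using that unfolding powr_minus by (subst powr_half_sqrt) (simp_all add: field_simps)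
    moreover have "sqrt (2 * pi) = 2 powr (1/2) * sqrt pi"
      by (simp add: powr_half_sqrt real_sqrt_mult)
    ultimately show ?thesis
      using that by (simp add: \<phi>_def h_def std_normal_density_def Gamma_one_half_real)
  qed
  have emeas: "emeasure (distr std_normal borel (\<lambda>x. x\<^sup>2)) {..t} = emeasure (chi_sq 1) {..t}" for t
  proof -
    have "(\<integral>\<^sup>+x. indicator {..t} x \<partial>distr std_normal borel (\<lambda>x. x\<^sup>2))
        = (\<integral>\<^sup>+x. ennreal (\<phi> x) * indicator {..t} (x\<^sup>2) \<partial>lborel)"
      unfolding \<phi>_def by (subst nn_integral_distr, simp, simp, subst nn_integral_density, auto)
    then have L: "emeasure (distr std_normal borel (\<lambda>x. x\<^sup>2)) {..t} 
        = (\<integral>\<^sup>+x. ennreal (\<phi> x) * indicator {..t} (x\<^sup>2) \<partial>lborel)"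
      by simp
    have R: "emeasure (chi_sq 1) {..t} = (\<integral>\<^sup>+x. ennreal (h x) * indicator {..t} x \<partial>lborel)"
      unfolding chi_sq_def h_def by (subst emeasure_density) auto
    show ?thesis
    proof (cases "0 < t")
      case False
      show ?thesis
        unfolding L R
      proof (intro nn_integral_cong_AE, rule eventually_mono[OF AE_lborel_singleton[of 0]])
        fix x :: real assume "x \<noteq> 0"
        then have "\<not> x\<^sup>2 \<le> t" using False by (smt (verit) zero_less_power2)
        moreover have "ennreal (h x) * indicator {..t} x = 0"
          using False by (cases "x \<le> t") (auto simp: h0)
        ultimately show "ennreal (\<phi> x) * indicator {..t} (x\<^sup>2) = ennreal (h x) * indicator {..t} x"
          by simp
      qed
    next
      case True
      define r where "r = sqrt t"
      have r: "0 < r" "t = r\<^sup>2" using True by (auto simp: r_def)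
      have s: "x\<^sup>2 \<le> r\<^sup>2 \<longleftrightarrow> -r \<le> x \<and> x \<le> r" for x
        using r(1) by (metis abs_le_iff abs_le_square_iff abs_of_pos minus_le_iff conj_commute)
      have reflect: "(\<integral>\<^sup>+x. ennreal (\<phi> x) * indicator {-r..0} x \<partial>lborel)
         = (\<integral>\<^sup>+x. ennreal (\<phi> x) * indicator {0..r} x \<partial>lborel)"
        by (subst nn_integral_real_affine[where c="-1" and t=0])
           (auto intro!: nn_integral_cong simp: indicator_def even)
      \<comment> \<open>The two halves overlap only at 0, a null set.\<close>
      have "emeasure (distr std_normal borel (\<lambda>x. x\<^sup>2)) {..t}
        = (\<integral>\<^sup>+x. ennreal (\<phi> x) * indicator {0..r} x + ennreal (\<phi> x) * indicator {-r..0} x \<partial>lborel)"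
        unfolding L unfolding r(2)
        by (intro nn_integral_cong_AE, rule eventually_mono[OF AE_lborel_singleton[of 0]])
           (auto simp: indicator_def s)
      also have "\<dots> = (\<integral>\<^sup>+x. ennreal (\<phi> x) * indicator {0..r} x \<partial>lborel)
         + (\<integral>\<^sup>+x. ennreal (\<phi> x) * indicator {0..r} x \<partial>lborel)"
        by (subst nn_integral_add) (auto simp: reflect)
      also have "\<dots> = (\<integral>\<^sup>+x. ennreal (\<phi> x) * indicator {0..r} x + ennreal (\<phi> x) * indicator {0..r} x \<partial>lborel)"
        by (subst nn_integral_add) auto
      also have "\<dots> = (\<integral>\<^sup>+x. ennreal (h (x\<^sup>2) * (2 * x) * indicator {0..r} x) \<partial>lborel)"
      proof (intro nn_integral_cong_AE, rule eventually_mono[OF AE_lborel_singleton[of 0]])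
        fix x :: real assume x: "x \<noteq> 0"
        show "ennreal (\<phi> x) * indicator {0..r} x + ennreal (\<phi> x) * indicator {0..r} x
          = ennreal (h (x\<^sup>2) * (2 * x) * indicator {0..r} x)"
        proof (cases "x \<in> {0..r}")
          case True
          then have "h (x\<^sup>2) * (2 * x) = \<phi> x + \<phi> x" using subst[of x] x by simp
          then have "ennreal (h (x\<^sup>2) * (2 * x)) = ennreal (\<phi> x) + ennreal (\<phi> x)"
            by (simp only: ennreal_plus \<phi>0)
          with True show ?thesis by simp
        qed simp
      qed
      also have "\<dots> = (\<integral>\<^sup>+x. ennreal (h x * indicator {0\<^sup>2..r\<^sup>2} x) \<partial>lborel)"
      proof (rule nn_integral_substitution[symmetric])
        show "set_borel_measurable borel {0\<^sup>2..r\<^sup>2} h"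
          by (simp add: set_borel_measurable_def)
        show "((\<lambda>x. x\<^sup>2) has_real_derivative 2 * x) (at x)" for x :: real
          by (auto intro!: derivative_eq_intros)
      qed (use r in \<open>auto intro!: continuous_intros\<close>)
      also have "\<dots> = (\<integral>\<^sup>+x. ennreal (h x) * indicator {..t} x \<partial>lborel)"
        using h0 by (intro nn_integral_cong) (auto simp: r(2) not_le split: split_indicator)
      finally show ?thesis unfolding R .
    qed
  qed
  show "cdf (distr std_normal borel (\<lambda>x. x\<^sup>2)) = cdf (chi_sq 1)"
    by (rule ext) (simp add: cdf_def measure_def emeas)
qed

section \<open>Quadratic forms of a standard normal vector\<close>

lemma nn_integral_density_std_normal:
  assumes [measurable]: "f \<in> borel_measurable borel"
  shows "(\<integral>\<^sup>+x. f x \<partial>std_normal) = (\<integral>\<^sup>+x. ennreal (std_normal_density x) * f x \<partial>lborel)"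
  by (subst nn_integral_density) auto

text \<open>The rotation is split into two one-dimensional affine substitutions, first in \<open>y\<close>, then,
  after exchanging the integrals, in \<open>x\<close>.\<close>

lemma nn_integral_std_normal_rotate:
  fixes f :: "real \<Rightarrow> real \<Rightarrow> ennreal"
  assumes [measurable]: "case_prod f \<in> borel_measurable (borel \<Otimes>\<^sub>M borel)"
    and s: "s \<noteq> 0" and cs: "c\<^sup>2 + s\<^sup>2 = 1"
  shows "(\<integral>\<^sup>+x. \<integral>\<^sup>+y. f (c * x + s * y) (c * y - s * x) \<partial>std_normal \<partial>std_normal) =
         (\<integral>\<^sup>+w. \<integral>\<^sup>+v. f w v \<partial>std_normal \<partial>std_normal)"
proof -
  let ?\<phi> = "\<lambda>x. ennreal (std_normal_density x)"
  have "(\<integral>\<^sup>+x. \<integral>\<^sup>+y. f (c * x + s * y) (c * y - s * x) \<partial>std_normal \<partial>std_normal)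
     = (\<integral>\<^sup>+x. ?\<phi> x * (\<integral>\<^sup>+y. ?\<phi> y * f (c * x + s * y) (c * y - s * x) \<partial>lborel) \<partial>lborel)"
    by (subst nn_integral_density_std_normal, measurable)
       (auto intro!: nn_integral_cong simp: nn_integral_density_std_normal)
  \<comment> \<open>Substitution \<open>y = (w - c * x) / s\<close> in the inner integral;
    \<open>c^2 + s^2 = 1\<close> simplifies the second argument of \<open>f\<close> to
    \<open>(c * w - x) / s\<close>.\<close>
  also have "\<dots> = (\<integral>\<^sup>+x. ?\<phi> x * (ennreal \<bar>1/s\<bar> * (\<integral>\<^sup>+w. ?\<phi> ((w - c * x) / s) * f w ((c * w - x) / s) \<partial>lborel)) \<partial>lborel)"
  proof (intro nn_integral_cong arg_cong2[where f="(*)"] refl)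
    fix x
    have 1: "c * x + s * (- (c * x / s) + 1 / s * w) = w" for w
      using s by (simp add: field_simps)
    have 2: "- (c * x / s) + 1 / s * w = (w - c * x) / s" for w
      using s by (simp add: field_simps)
    have "c * ((w - c * x) / s) - s * x = (c * w - (c\<^sup>2 + s\<^sup>2) * x) / s" for w
      using s by (simp add: field_simps power2_eq_square)
    then have 3: "c * ((w - c * x) / s) - s * x = (c * w - x) / s" for w
      by (simp add: cs)
    show "(\<integral>\<^sup>+y. ?\<phi> y * f (c * x + s * y) (c * y - s * x) \<partial>lborel)
       = ennreal \<bar>1/s\<bar> * (\<integral>\<^sup>+w. ?\<phi> ((w - c * x) / s) * f w ((c * w - x) / s) \<partial>lborel)"
      using s
      by (subst nn_integral_real_affine[where c="1/s" and t="- (c * x / s)"])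
         (simp_all only: 1 2 3, auto)
  qed
  also have "\<dots> = (\<integral>\<^sup>+x. \<integral>\<^sup>+w. ennreal \<bar>1/s\<bar> * (?\<phi> x * (?\<phi> ((w - c * x) / s) * f w ((c * w - x) / s))) \<partial>lborel \<partial>lborel)"
    by (auto intro!: nn_integral_cong simp: nn_integral_cmult[symmetric] mult.left_commute)
  also have "\<dots> = (\<integral>\<^sup>+w. \<integral>\<^sup>+x. ennreal \<bar>1/s\<bar> * (?\<phi> x * (?\<phi> ((w - c * x) / s) * f w ((c * w - x) / s))) \<partial>lborel \<partial>lborel)"
    by (rule lborel_pair.Fubini') measurable
  \<comment> \<open>Substitution \<open>x = c * w - s * v\<close>; its Jacobian cancels the factor
    \<open>1/s\<close> of the first one.\<close>
  also have "\<dots> = (\<integral>\<^sup>+w. ennreal \<bar>-s\<bar> * (\<integral>\<^sup>+v. ennreal \<bar>1/s\<bar> * (?\<phi> (c * w - s * v) * (?\<phi> (s * w + c * v) * f w v)) \<partial>lborel) \<partial>lborel)"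
  proof (intro nn_integral_cong)
    fix w
    have "(w - c * (c * w - s * v)) / s = ((c\<^sup>2 + s\<^sup>2) * w - c * (c * w - s * v)) / s" for v
      by (simp add: cs)
    also have "\<dots> v = s * w + c * v" for v
      using s by (simp add: field_simps power2_eq_square)
    finally have 1: "(w - c * (c * w - s * v)) / s = s * w + c * v" for v .
    have 2: "(c * w - (c * w - s * v)) / s = v" "c * w + - s * v = c * w - s * v" for v
      using s by auto
    show "(\<integral>\<^sup>+x. ennreal \<bar>1/s\<bar> * (?\<phi> x * (?\<phi> ((w - c * x) / s) * f w ((c * w - x) / s))) \<partial>lborel)
       = ennreal \<bar>-s\<bar> * (\<integral>\<^sup>+v. ennreal \<bar>1/s\<bar> * (?\<phi> (c * w - s * v) * (?\<phi> (s * w + c * v) * f w v)) \<partial>lborel)"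
      using s
      by (subst nn_integral_real_affine[where c="-s" and t="c * w"])
         (simp_all only: 1 2, auto)
  qed
  also have "\<dots> = (\<integral>\<^sup>+w. \<integral>\<^sup>+v. ?\<phi> w * (?\<phi> v * f w v) \<partial>lborel \<partial>lborel)"
  proof (intro nn_integral_cong)
    fix w
    \<comment> \<open>A rotation preserves the Euclidean norm, and the product of two standard
      normal densities depends on the norm alone.\<close>
    have "(c * w - s * v)\<^sup>2 + (s * w + c * v)\<^sup>2 = (c\<^sup>2 + s\<^sup>2) * (w\<^sup>2 + v\<^sup>2)" for v
      by (simp add: power2_eq_square algebra_simps)
    then have "exp (- (c * w - s * v)\<^sup>2 / 2) * exp (- (s * w + c * v)\<^sup>2 / 2) = exp (- w\<^sup>2 / 2) * exp (- v\<^sup>2 / 2)" for v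
      unfolding exp_add[symmetric] add_divide_distrib[symmetric] minus_add_distrib[symmetric] cs
      by simp
    then have *: "std_normal_density (c * w - s * v) * std_normal_density (s * w + c * v)
       = std_normal_density w * std_normal_density v" for v
      by (simp add: normal_density_def)
    have "ennreal \<bar>-s\<bar> * (\<integral>\<^sup>+v. ennreal \<bar>1/s\<bar> * (?\<phi> (c * w - s * v) * (?\<phi> (s * w + c * v) * f w v)) \<partial>lborel)
       = (\<integral>\<^sup>+v. ennreal \<bar>-s\<bar> * (ennreal \<bar>1/s\<bar> * (?\<phi> (c * w - s * v) * (?\<phi> (s * w + c * v) * f w v))) \<partial>lborel)"
      by (rule nn_integral_cmult[symmetric]) measurable
    also have "\<dots> = (\<integral>\<^sup>+v. ?\<phi> w * (?\<phi> v * f w v) \<partial>lborel)"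
    proof (intro nn_integral_cong)
      fix v
      have "ennreal \<bar>-s\<bar> * (ennreal \<bar>1/s\<bar> * (?\<phi> (c * w - s * v) * (?\<phi> (s * w + c * v) * f w v)))
         = (ennreal \<bar>-s\<bar> * ennreal \<bar>1/s\<bar>) * ((?\<phi> (c * w - s * v) * ?\<phi> (s * w + c * v)) * f w v)"
        by (simp only: mult.assoc)
      also have "ennreal \<bar>-s\<bar> * ennreal \<bar>1/s\<bar> = 1"
        using s by (simp add: ennreal_mult'[symmetric])
      also have "?\<phi> (c * w - s * v) * ?\<phi> (s * w + c * v) = ?\<phi> w * ?\<phi> v"
        using * by (simp add: ennreal_mult'[symmetric])
      finally show "ennreal \<bar>-s\<bar> * (ennreal \<bar>1/s\<bar> * (?\<phi> (c * w - s * v) * (?\<phi> (s * w + c * v) * f w v)))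
         = ?\<phi> w * (?\<phi> v * f w v)"
        by (simp add: mult.assoc)
    qed
    finally show "ennreal \<bar>-s\<bar> * (\<integral>\<^sup>+v. ennreal \<bar>1/s\<bar> * (?\<phi> (c * w - s * v) * (?\<phi> (s * w + c * v) * f w v)) \<partial>lborel)
       = (\<integral>\<^sup>+v. ?\<phi> w * (?\<phi> v * f w v) \<partial>lborel)" .
  qed
  also have "\<dots> = (\<integral>\<^sup>+w. \<integral>\<^sup>+v. f w v \<partial>std_normal \<partial>std_normal)"
    by (subst nn_integral_density_std_normal, measurable)
       (auto intro!: nn_integral_cong simp: nn_integral_density_std_normal nn_integral_cmult)
  finally show ?thesis .
qed

lemma prob_space_std_normal: "prob_space std_normal"
  by (rule prob_space_normal_density) simp

text \<open>Zero degrees of freedom must mean the point mass at 0, the law of the quadratic form in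
  a single coordinate, where the induction starts. \<open>chi_sq 0\<close> would be the null
  measure, since \<open>Gamma 0 = 0\<close> and division by zero gives 0.\<close>

definition chi_sq_nat :: "nat \<Rightarrow> real measure" where
  "chi_sq_nat n = (if n = 0 then return borel 0 else chi_sq (real n))"

lemma sets_chi_sq_nat [simp, measurable_cong]: "sets (chi_sq_nat n) = sets borel"
  by (simp add: chi_sq_nat_def)

lemma prob_space_chi_sq_nat: "prob_space (chi_sq_nat n)"
  by (auto simp: chi_sq_nat_def intro!: prob_space_return prob_space_chi_sq)

text \<open>An independent squared normal has law \<open>chi_sq 1\<close>, and convolution with it
  adds one degree of freedom; for \<open>n = 0\<close> the first summand is the constant 0.\<close>

lemma nn_integral_chi_sq_nat_Suc:
  assumes [measurable]: "f \<in> borel_measurable borel"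
  shows "(\<integral>\<^sup>+t. \<integral>\<^sup>+v. f (t + v\<^sup>2) \<partial>std_normal \<partial>chi_sq_nat n) = (\<integral>\<^sup>+t. f t \<partial>chi_sq_nat (Suc n))"
proof -
  have square: "(\<integral>\<^sup>+v. g (v\<^sup>2) \<partial>std_normal) = (\<integral>\<^sup>+v. g v \<partial>chi_sq 1)"
    if [measurable]: "g \<in> borel_measurable borel" for g :: "real \<Rightarrow> ennreal"
    unfolding distr_std_normal_power2[symmetric] by (subst nn_integral_distr) auto
  have "(\<integral>\<^sup>+t. \<integral>\<^sup>+v. f (t + v\<^sup>2) \<partial>std_normal \<partial>chi_sq_nat n)
      = (\<integral>\<^sup>+t. \<integral>\<^sup>+v. f (t + v) \<partial>chi_sq 1 \<partial>chi_sq_nat n)"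
    by (intro nn_integral_cong square) auto
  also have "\<dots> = (\<integral>\<^sup>+t. f t \<partial>chi_sq_nat (Suc n))"
  proof (cases "n = 0")
    case True
    interpret C: prob_space "chi_sq 1" by (rule prob_space_chi_sq) simp
    show ?thesis using True
      by (simp add: chi_sq_nat_def, subst nn_integral_return) auto
  next
    case False
    then have "chi_sq_nat (Suc n) = convolution (chi_sq_nat n) (chi_sq 1)"
      by (simp add: chi_sq_nat_def convolution_chi_sq add.commute)
    then show ?thesis
      by (simp add: nn_integral_convolution prob_space.finite_measure prob_space_chi_sq prob_space_chi_sq_nat)
  qed
  finally show ?thesis .
qed

text \<open>The joint law, with independence of the residual form and the projection on
  \<open>u\<close>, is what the induction can carry. A new coordinate \<open>y\<close> mixes with
  the old projection \<open>w\<close>; rotating the pair yields the new projection and, independent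
  of it, one further square that joins the residual.\<close>

lemma nn_integral_std_normal_quadratic_form:
  fixes f :: "real \<Rightarrow> real \<Rightarrow> ennreal" and u :: "nat \<Rightarrow> real"
  assumes [measurable]: "case_prod f \<in> borel_measurable (borel \<Otimes>\<^sub>M borel)"
    and u: "\<And>i. i < Suc n \<Longrightarrow> 0 < u i" "(\<Sum>i<Suc n. (u i)\<^sup>2) = 1"
  shows "(\<integral>\<^sup>+z. f ((\<Sum>i<Suc n. (z i)\<^sup>2) - (\<Sum>i<Suc n. u i * z i)\<^sup>2) (\<Sum>i<Suc n. u i * z i)
            \<partial>PiM {..<Suc n} (\<lambda>_. std_normal))
       = (\<integral>\<^sup>+t. \<integral>\<^sup>+w. f t w \<partial>std_normal \<partial>chi_sq_nat n)"
  using assms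
proof (induction n arbitrary: u f)
  case (0 u f)
  note [measurable] = 0(1)
  interpret N: product_sigma_finite "\<lambda>_::nat. std_normal"
    by (simp add: product_sigma_finite_def prob_space_std_normal prob_space_imp_sigma_finite)
  have "u 0 = 1"
    using 0(2)[of 0] 0(3) by (simp add: power2_eq_1_iff)
  then have "(\<integral>\<^sup>+z. f ((\<Sum>i<Suc 0. (z i)\<^sup>2) - (\<Sum>i<Suc 0. u i * z i)\<^sup>2) (\<Sum>i<Suc 0. u i * z i)
            \<partial>PiM {..<Suc 0} (\<lambda>_. std_normal)) = (\<integral>\<^sup>+z. f 0 (z 0) \<partial>PiM {0::nat} (\<lambda>_. std_normal))"
    by (simp add: lessThan_Suc)
  also have "\<dots> = (\<integral>\<^sup>+w. f 0 w \<partial>std_normal)"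
    by (rule N.product_nn_integral_singleton) measurable
  also have "\<dots> = (\<integral>\<^sup>+t. \<integral>\<^sup>+w. f t w \<partial>std_normal \<partial>chi_sq_nat 0)"
  proof -
    interpret S: prob_space std_normal by (rule prob_space_std_normal)
    show ?thesis by (simp add: chi_sq_nat_def, subst nn_integral_return) auto
  qed
  finally show ?case .
next
  case (Suc n u f)
  note [measurable] = Suc.prems(1)
  interpret N: product_sigma_finite "\<lambda>_::nat. std_normal"
    by (simp add: product_sigma_finite_def prob_space_std_normal prob_space_imp_sigma_finite)
  interpret S: prob_space std_normal by (rule prob_space_std_normal)
  interpret C: prob_space "chi_sq_nat n" by (rule prob_space_chi_sq_nat)
  interpret C': prob_space "chi_sq_nat (Suc n)" by (rule prob_space_chi_sq_nat)
  interpret CS: pair_sigma_finite "chi_sq_nat n" std_normal ..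
  interpret CS': pair_sigma_finite "chi_sq_nat (Suc n)" std_normal ..
  define m where "m = Suc n"
  define c where "c = u m"
  \<comment> \<open>The norm of the old coefficients: dividing by \<open>\<rho>\<close> makes them a
    unit vector again, and \<open>(\<rho>, c)\<close> lies on the unit circle, so it defines the
    rotation.\<close>
  define \<rho> where "\<rho> = sqrt (\<Sum>i<m. (u i)\<^sup>2)"
  have \<rho>2: "\<rho>\<^sup>2 = (\<Sum>i<m. (u i)\<^sup>2)"
    by (simp add: \<rho>_def sum_nonneg)
  have "0 < (\<Sum>i<m. (u i)\<^sup>2)"
  proof (rule sum_pos)
    show "0 < (u i)\<^sup>2" if "i \<in> {..<m}" for i
      using that Suc.prems(2)[of i] by (simp add: m_def)
  qed (auto simp: m_def)
  then have \<rho>: "0 < \<rho>" by (simp add: \<rho>_def)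
  have c: "0 < c" using Suc.prems(2) by (simp add: c_def m_def)
  have one: "\<rho>\<^sup>2 + c\<^sup>2 = 1"
    using Suc.prems(3) by (simp add: \<rho>2 c_def m_def)
  define u' where "u' i = u i / \<rho>" for i
  \<comment> \<open>Integrating out the last coordinate leaves a function of the old residual and
    the old projection, to which the induction hypothesis applies with \<open>g\<close> in place of
    \<open>f\<close>.\<close>
  define g where "g t w = (\<integral>\<^sup>+y. f (t + (\<rho> * y - c * w)\<^sup>2) (\<rho> * w + c * y) \<partial>std_normal)" for t w
  have g_meas: "case_prod g \<in> borel_measurable (borel \<Otimes>\<^sub>M borel)"
    unfolding g_def by measurable
  have u': "0 < u' i" if "i < Suc n" for i
    using that \<rho> Suc.prems(2)[of i] by (simp add: u'_def)
  have u'1: "(\<Sum>i<Suc n. (u' i)\<^sup>2) = 1"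
    using \<rho> by (simp add: u'_def power_divide sum_divide_distrib[symmetric] \<rho>2 m_def[symmetric] del: sum.lessThan_Suc)
       (simp add: \<rho>2[symmetric])
  have split: "f ((\<Sum>i<Suc m. ((x(m := y)) i)\<^sup>2) - (\<Sum>i<Suc m. u i * (x(m := y)) i)\<^sup>2) (\<Sum>i<Suc m. u i * (x(m := y)) i)
     = f (((\<Sum>i<m. (x i)\<^sup>2) - (\<Sum>i<m. u' i * x i)\<^sup>2) + (\<rho> * y - c * (\<Sum>i<m. u' i * x i))\<^sup>2)
         (\<rho> * (\<Sum>i<m. u' i * x i) + c * y)" for x y
  proof -
    define W where "W = (\<Sum>i<m. u' i * x i)"
    have "(\<Sum>i<m. u i * (x(m := y)) i) = \<rho> * W"
      using \<rho> by (auto simp: W_def u'_def sum_distrib_left intro!: sum.cong)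
    then have 1: "(\<Sum>i<Suc m. u i * (x(m := y)) i) = \<rho> * W + c * y"
      by (simp add: c_def)
    have "(\<Sum>i<m. ((x(m := y)) i)\<^sup>2) = (\<Sum>i<m. (x i)\<^sup>2)"
      by (intro sum.cong) auto
    then have 2: "(\<Sum>i<Suc m. ((x(m := y)) i)\<^sup>2) = (\<Sum>i<m. (x i)\<^sup>2) + y\<^sup>2"
      by simp
    \<comment> \<open>Invariance of the norm under the rotation: what the new projection does not
      absorb of \<open>W^2 + y^2\<close> is the square of the other rotated coordinate.\<close>
    have "W\<^sup>2 + y\<^sup>2 = (\<rho>\<^sup>2 + c\<^sup>2) * (W\<^sup>2 + y\<^sup>2)"
      by (simp add: one)
    also have "\<dots> = (\<rho> * W + c * y)\<^sup>2 + (\<rho> * y - c * W)\<^sup>2"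
      by (simp add: power2_eq_square algebra_simps)
    finally have 3: "(\<Sum>i<m. (x i)\<^sup>2) + y\<^sup>2 - (\<rho> * W + c * y)\<^sup>2 = ((\<Sum>i<m. (x i)\<^sup>2) - W\<^sup>2) + (\<rho> * y - c * W)\<^sup>2"
      by simp
    show ?thesis
      unfolding 1 2 3 W_def[symmetric] ..
  qed
  have "(\<integral>\<^sup>+z. f ((\<Sum>i<Suc m. (z i)\<^sup>2) - (\<Sum>i<Suc m. u i * z i)\<^sup>2) (\<Sum>i<Suc m. u i * z i)
            \<partial>PiM {..<Suc m} (\<lambda>_. std_normal))
     = (\<integral>\<^sup>+x. g ((\<Sum>i<m. (x i)\<^sup>2) - (\<Sum>i<m. u' i * x i)\<^sup>2) (\<Sum>i<m. u' i * x i)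
            \<partial>PiM {..<m} (\<lambda>_. std_normal))"
    (is "(\<integral>\<^sup>+z. ?F z \<partial>_) = ?R")
  proof -
    have "?F \<in> borel_measurable (PiM {..<Suc m} (\<lambda>_. std_normal))"
      by measurable
    then have "(\<integral>\<^sup>+z. ?F z \<partial>PiM {..<Suc m} (\<lambda>_. std_normal))
        = (\<integral>\<^sup>+x. \<integral>\<^sup>+y. ?F (x(m := y)) \<partial>std_normal \<partial>PiM {..<m} (\<lambda>_. std_normal))"
      unfolding lessThan_Suc by (intro N.product_nn_integral_insert) auto
    also have "\<dots> = ?R"
      by (simp only: split g_def)
    finally show ?thesis .
  qed
  also have "\<dots> = (\<integral>\<^sup>+t. \<integral>\<^sup>+w. g t w \<partial>std_normal \<partial>chi_sq_nat n)"
    unfolding m_def by (rule Suc.IH[OF g_meas u' u'1])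
  also have "\<dots> = (\<integral>\<^sup>+t. \<integral>\<^sup>+w. \<integral>\<^sup>+v. f (t + v\<^sup>2) w \<partial>std_normal \<partial>std_normal \<partial>chi_sq_nat n)"
    unfolding g_def using c one
    by (intro nn_integral_cong nn_integral_std_normal_rotate[where f="\<lambda>w v. f (_ + v\<^sup>2) w"]) auto
  \<comment> \<open>The projection \<open>w\<close> is moved outside, so that the residual
    \<open>t\<close> and the new square become adjacent and can be convolved.\<close>
  also have "\<dots> = (\<integral>\<^sup>+w. \<integral>\<^sup>+t. \<integral>\<^sup>+v. f (t + v\<^sup>2) w \<partial>std_normal \<partial>chi_sq_nat n \<partial>std_normal)"
    by (rule CS.Fubini'[symmetric]) measurable
  also have "\<dots> = (\<integral>\<^sup>+w. \<integral>\<^sup>+t. f t w \<partial>chi_sq_nat (Suc n) \<partial>std_normal)"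
    by (intro nn_integral_cong nn_integral_chi_sq_nat_Suc) auto
  also have "\<dots> = (\<integral>\<^sup>+t. \<integral>\<^sup>+w. f t w \<partial>std_normal \<partial>chi_sq_nat (Suc n))"
    by (rule CS'.Fubini') measurable
  finally show ?case by (simp only: m_def)
qed

text \<open>The first marginal of the joint law. The law is the same for every admissible
  \<open>u\<close>, so \<open>u\<close> may later depend on the sample size.\<close>

lemma distr_std_normal_quadratic_form:
  assumes k: "2 \<le> k" and u: "\<And>i. i < k \<Longrightarrow> 0 < u i" "(\<Sum>i<k. (u i)\<^sup>2) = 1"
  shows "distr (PiM {..<k} (\<lambda>_. std_normal)) borel (\<lambda>z. (\<Sum>i<k. (z i)\<^sup>2) - (\<Sum>i<k. u i * z i)\<^sup>2)
       = chi_sq (real k - 1)" (is "?L = _")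
proof (rule measure_eqI)
  interpret S: prob_space std_normal by (rule prob_space_std_normal)
  obtain n where n: "k = Suc n" "n \<noteq> 0" using k by (cases k) auto
  then have C: "chi_sq (real k - 1) = chi_sq_nat n" by (simp add: chi_sq_nat_def)
  fix B assume "B \<in> sets ?L"
  then have [measurable]: "B \<in> sets borel" by simp
  have "emeasure ?L B = (\<integral>\<^sup>+x. indicator B x \<partial>?L)"
    by simp
  also have "\<dots> = (\<integral>\<^sup>+z. indicator B ((\<Sum>i<k. (z i)\<^sup>2) - (\<Sum>i<k. u i * z i)\<^sup>2) \<partial>PiM {..<k} (\<lambda>_. std_normal))"
    by (rule nn_integral_distr) measurable
  also have "\<dots> = (\<integral>\<^sup>+t. \<integral>\<^sup>+w. indicator B t \<partial>std_normal \<partial>chi_sq_nat n)"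
    using nn_integral_std_normal_quadratic_form[of "\<lambda>t w. indicator B t" n u] u by (simp add: n)
  also have "\<dots> = emeasure (chi_sq (real k - 1)) B"
    using S.emeasure_space_1 by (simp add: C)
  finally show "emeasure ?L B = emeasure (chi_sq (real k - 1)) B" .
qed simp

section \<open>Normal approximation of the gamma law\<close>

text \<open>With \<open>x = b + sqrt b * z\<close>, this is
  \<open>x powr (b - 1) * exp (- x)\<close> divided by its value at \<open>z = 0\<close>.\<close>

definition gamma_kernel :: "real \<Rightarrow> real \<Rightarrow> real" where
  "gamma_kernel b z = (if 0 < 1 + z / sqrt b then exp ((b - 1) * ln (1 + z / sqrt b) - sqrt b * z) else 0)"

lemma gamma_kernel_measurable [measurable]: "gamma_kernel b \<in> borel_measurable borel"
  unfolding gamma_kernel_def by measurable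

lemma gamma_kernel_nonneg: "0 \<le> gamma_kernel b z"
  by (simp add: gamma_kernel_def)

text \<open>The density of \<open>(G - b) / sqrt b\<close> for \<open>G\<close> of law
  \<open>gamma_meas b\<close>, whose mean and variance are both \<open>b\<close>;
  \<open>sqrt b\<close> in front is the Jacobian.\<close>

definition std_gamma_density :: "real \<Rightarrow> real \<Rightarrow> real" where
  "std_gamma_density b z = sqrt b * gamma_density b (b + sqrt b * z)"

lemma std_gamma_density_measurable [measurable]: "std_gamma_density b \<in> borel_measurable borel"
  unfolding std_gamma_density_def by measurable

lemma std_gamma_density_nonneg: "0 < b \<Longrightarrow> 0 \<le> std_gamma_density b z"
  using Gamma_real_pos[of b] by (auto simp: std_gamma_density_def)

lemma gamma_meas_eq_distr:
  assumes "0 < b"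
  shows "gamma_meas b = distr (density lborel (\<lambda>z. ennreal (std_gamma_density b z))) borel (\<lambda>z. b + sqrt b * z)"
proof (rule measure_eqI)
  have G: "0 < Gamma b" using assms by (rule Gamma_real_pos)
  fix B assume "B \<in> sets (gamma_meas b)"
  then have [measurable]: "B \<in> sets borel" using assms by (simp add: gamma_meas_def)
  have "emeasure (gamma_meas b) B = (\<integral>\<^sup>+x. ennreal (gamma_density b x) * indicator B x \<partial>lborel)"
    using assms by (simp add: gamma_meas_def emeasure_density cong: if_cong)
  also have "\<dots> = ennreal (sqrt b) *
      (\<integral>\<^sup>+z. ennreal (gamma_density b (b + sqrt b * z)) * indicator B (b + sqrt b * z) \<partial>lborel)"
    using assms by (subst nn_integral_real_affine[where c="sqrt b" and t=b]) auto
  also have "\<dots> = (\<integral>\<^sup>+z. ennreal (sqrt b) *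
      (ennreal (gamma_density b (b + sqrt b * z)) * indicator B (b + sqrt b * z)) \<partial>lborel)"
    by (rule nn_integral_cmult[symmetric]) measurable
  also have "\<dots> = (\<integral>\<^sup>+z. ennreal (std_gamma_density b z) * indicator B (b + sqrt b * z) \<partial>lborel)"
    unfolding std_gamma_density_def using assms by (subst ennreal_mult') (simp_all only: mult.assoc real_sqrt_ge_zero less_imp_le)
  also have "\<dots> = emeasure (distr (density lborel (\<lambda>z. ennreal (std_gamma_density b z))) borel (\<lambda>z. b + sqrt b * z)) B"
    by (subst nn_integral_indicator[symmetric], simp, subst nn_integral_distr, simp, simp, subst nn_integral_density) auto
  finally show "emeasure (gamma_meas b) B = \<dots>" .
qed (use assms in \<open>simp add: gamma_meas_def\<close>)

lemma prob_space_std_gamma: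
  assumes "0 < b"
  shows "prob_space (density lborel (\<lambda>z. ennreal (std_gamma_density b z)))"
  using prob_space_gamma_meas[OF assms] unfolding gamma_meas_eq_distr[OF assms]
  by (rule prob_space_distrD[rotated]) simp

text \<open>Separating the constant from the kernel lets the shape be bounded and passed to the
  limit before anything is known about the growth of \<open>Gamma\<close>.\<close>

lemma std_gamma_density_eq:
  assumes b: "0 < b"
  shows "std_gamma_density b z = (b powr (b - 1/2) * exp (- b) / Gamma b) * gamma_kernel b z"
proof -
  have sb: "0 < sqrt b" "sqrt b * sqrt b = b" using b by auto
  have eq: "b + sqrt b * z = b * (1 + z / sqrt b)"
    using sb by (simp add: field_simps)
  show ?thesis
  proof (cases "0 < 1 + z / sqrt b")
    case False
    then have "\<not> 0 < b + sqrt b * z"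
      unfolding eq using b by (simp add: zero_less_mult_iff)
    with False show ?thesis
      by (simp add: std_gamma_density_def gamma_kernel_def)
  next
    case True
    then have "0 < b + sqrt b * z"
      unfolding eq using b by simp
    then have "std_gamma_density b z = sqrt b * ((b * (1 + z / sqrt b)) powr (b - 1) * exp (- (b + sqrt b * z)) / Gamma b)"
      by (simp only: std_gamma_density_def if_True eq[symmetric])
    also have "(b * (1 + z / sqrt b)) powr (b - 1) = b powr (b - 1) * (1 + z / sqrt b) powr (b - 1)"
      using True b by (simp add: powr_mult)
    also have "(1 + z / sqrt b) powr (b - 1) = exp ((b - 1) * ln (1 + z / sqrt b))"
      using True by (simp add: powr_def)
    also have "exp (- (b + sqrt b * z)) = exp (- b) * exp (- (sqrt b * z))"
      by (simp add: exp_add[symmetric])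
    also have "sqrt b * (b powr (b - 1) * exp ((b - 1) * ln (1 + z / sqrt b)) * (exp (- b) * exp (- (sqrt b * z))) / Gamma b)
       = (sqrt b * b powr (b - 1)) * exp (- b) / Gamma b * (exp ((b - 1) * ln (1 + z / sqrt b)) * exp (- (sqrt b * z)))"
      by (simp only: times_divide_eq_left times_divide_eq_right mult_ac)
    also have "sqrt b * b powr (b - 1) = b powr (b - 1/2)"
      using b by (simp add: powr_half_sqrt[symmetric] powr_add[symmetric])
    also have "exp ((b - 1) * ln (1 + z / sqrt b)) * exp (- (sqrt b * z)) = gamma_kernel b z"
      using True by (simp add: gamma_kernel_def exp_add[symmetric])
    finally show ?thesis .
  qed
qed

text \<open>The gap has derivative \<open>x^2 / (2 * (1 + x)^2)\<close>. The bound
  \<open>u - u^2 / 2\<close> fails for positive \<open>u\<close>; the damped quadratic term still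
  grows linearly, which is enough for an exponential tail.\<close>

lemma ln_one_plus_le_pos:
  fixes u :: real
  assumes "0 \<le> u"
  shows "ln (1 + u) \<le> u - u\<^sup>2 / (2 * (1 + u))"
proof -
  define f where "f u = u - u\<^sup>2 / (2 * (1 + u)) - ln (1 + u)" for u :: real
  have "f 0 \<le> f u"
  proof (rule DERIV_nonneg_imp_nondecreasing[OF assms])
    fix x :: real assume x: "0 \<le> x" "x \<le> u"
    have "(f has_real_derivative (1 - (2 * x * (2 * (1 + x)) - x\<^sup>2 * 2) / (2 * (1 + x))\<^sup>2 - 1 / (1 + x))) (at x)"
      unfolding f_def using x by (auto intro!: derivative_eq_intros simp: power2_eq_square)
    moreover have "1 - (2 * x * (2 * (1 + x)) - x\<^sup>2 * 2) / (2 * (1 + x))\<^sup>2 - 1 / (1 + x) = x\<^sup>2 / (2 * (1 + x)\<^sup>2)"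
      using x by (simp add: divide_simps) (simp add: power2_eq_square algebra_simps)
    ultimately show "\<exists>y. (f has_real_derivative y) (at x) \<and> 0 \<le> y"
      by (metis divide_nonneg_nonneg mult_nonneg_nonneg zero_le_numeral zero_le_power2)
  qed
  then show ?thesis by (simp add: f_def)
qed

text \<open>On this side the plain quadratic bound holds: the gap has derivative
  \<open>- x^2 / (1 + x)\<close> and decreases to its value 0 at 0.\<close>

lemma ln_one_plus_le_neg:
  fixes u :: real
  assumes "-1 < u" "u \<le> 0"
  shows "ln (1 + u) \<le> u - u\<^sup>2 / 2"
proof -
  define f where "f u = u - u\<^sup>2 / 2 - ln (1 + u)" for u :: real
  have "f 0 \<le> f u"
  proof (rule DERIV_nonpos_imp_nonincreasing[OF assms(2)])
    fix x :: real assume x: "u \<le> x" "x \<le> 0"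
    then have x1: "0 < 1 + x" using assms by simp
    have "(f has_real_derivative (1 - x - 1 / (1 + x))) (at x)"
      unfolding f_def using x1 by (auto intro!: derivative_eq_intros simp: power2_eq_square)
    moreover have "1 - x - 1 / (1 + x) = - (x\<^sup>2 / (1 + x))"
      using x1 by (simp add: divide_simps) (simp add: power2_eq_square algebra_simps)
    moreover have "- (x\<^sup>2 / (1 + x)) \<le> 0" using x1 by simp
    ultimately show "\<exists>y. (f has_real_derivative y) (at x) \<and> y \<le> 0"
      by metis
  qed
  then show ?thesis by (simp add: f_def)
qed

text \<open>The bound must be free of \<open>b\<close> to serve as a majorant. After the linear
  terms cancel, \<open>b * u^2 = z^2\<close> leaves a negative quadratic term; for
  \<open>z >= 0\<close> its damping \<open>1 + u\<close> is at most \<open>1 + z\<close>, because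
  \<open>b >= 1\<close>.\<close>

lemma scaled_ln_bound:
  assumes b: "1 \<le> b" and z: "0 < 1 + z / sqrt b"
  shows "b * ln (1 + z / sqrt b) - sqrt b * z \<le> (1 - \<bar>z\<bar>) / 2"
proof -
  define u where "u = z / sqrt b"
  have sb: "1 \<le> sqrt b" "sqrt b * sqrt b = b" using b by auto
  have zu: "z = sqrt b * u" using sb by (simp add: u_def)
  have bu: "b * u = sqrt b * z" "b * u\<^sup>2 = z\<^sup>2"
    using sb by (simp_all add: zu power_mult_distrib mult.assoc[symmetric] power2_eq_square[of "sqrt b"])
  show ?thesis
  proof (cases "0 \<le> z")
    case True
    then have u0: "0 \<le> u" using sb by (simp add: u_def)
    have uz: "u \<le> z" using sb u0 by (simp add: zu mult_le_cancel_right1)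
    have "b * ln (1 + u) \<le> b * (u - u\<^sup>2 / (2 * (1 + u)))"
      using ln_one_plus_le_pos[OF u0] b by (intro mult_left_mono) auto
    also have "\<dots> = sqrt b * z - z\<^sup>2 / (2 * (1 + u))"
      by (simp add: right_diff_distrib bu)
    finally have 1: "b * ln (1 + u) \<le> sqrt b * z - z\<^sup>2 / (2 * (1 + u))" .
    moreover define r where "r = z\<^sup>2 / (2 * (1 + u))"
    ultimately have 1: "b * ln (1 + u) \<le> sqrt b * z - r" by simp
    \<comment> \<open>Cleared of denominators this is \<open>z^2 - 1 \<le> z^2\<close>.\<close>
    have "(z - 1) / 2 \<le> z\<^sup>2 / (2 * (1 + z))"
      using True by (simp add: divide_simps) (simp add: power2_eq_square algebra_simps)
    also have "\<dots> \<le> z\<^sup>2 / (2 * (1 + u))"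
      using u0 uz True by (intro divide_left_mono) auto
    finally have "(z - 1) / 2 \<le> r" by (simp only: r_def)
    then have "b * ln (1 + u) - sqrt b * z \<le> - ((z - 1) / 2)"
      using 1 by linarith
    also have "\<dots> = (1 - \<bar>z\<bar>) / 2"
      using True by (simp add: field_simps)
    finally show ?thesis
      by (simp only: u_def)
  next
    case False
    then have u0: "u \<le> 0" "-1 < u" using sb z by (auto simp: u_def divide_nonpos_pos)
    have "b * ln (1 + u) \<le> b * (u - u\<^sup>2 / 2)"
      using ln_one_plus_le_neg[OF u0(2,1)] b by (intro mult_left_mono) auto
    also have "\<dots> = sqrt b * z - z\<^sup>2 / 2"
      by (simp add: right_diff_distrib bu)
    \<comment> \<open>This gives \<open>- z^2 / 2 \<le> z + 1/2\<close>, which for negative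
      \<open>z\<close> is below \<open>(1 + z) / 2\<close>.\<close>
    moreover have "0 \<le> (z + 1)\<^sup>2" by simp
    ultimately show ?thesis using False by (simp add: u_def power2_eq_square algebra_simps)
  qed
qed

text \<open>The logarithm of the kernel is \<open>(b - 1) / b\<close> times the quantity bounded in \<open>scaled_ln_bound\<close>,
  minus \<open>z / sqrt b\<close>; for \<open>b \<ge> 64\<close> the latter term is at most half of the resulting decay \<open>\<bar>z\<bar> / 4\<close>.\<close>

lemma gamma_kernel_bound:
  assumes b: "64 \<le> b"
  shows "gamma_kernel b z \<le> exp (1/2) * exp (- \<bar>z\<bar> / 8)"
proof (cases "0 < 1 + z / sqrt b")
  case False
  then show ?thesis by (simp add: gamma_kernel_def)
next
  case True
  have sb: "8 \<le> sqrt b" using b by (intro real_le_rsqrt) auto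
  have sbb: "sqrt b * sqrt b = b" using b by auto
  have "\<bar>z / sqrt b\<bar> \<le> \<bar>z\<bar> / 8"
  proof -
    have "\<bar>z\<bar> * 8 \<le> \<bar>z\<bar> * sqrt b" using sb by (intro mult_left_mono) auto
    moreover have "\<bar>sqrt b\<bar> = sqrt b" using sb by simp
    ultimately show ?thesis using sb b by (simp only: abs_divide divide_le_eq le_divide_eq times_divide_eq_left) (simp add: field_simps)
  qed
  define L where "L = b * ln (1 + z / sqrt b) - sqrt b * z"
  have L: "L \<le> (1 - \<bar>z\<bar>) / 2"
    unfolding L_def using b True by (intro scaled_ln_bound) auto
  have "z / sqrt b = sqrt b * z / b" using sbb sb b by (simp add: field_simps)
  then have "(b - 1) * ln (1 + z / sqrt b) - sqrt b * z = (b - 1) / b * L - z / sqrt b"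
    using b unfolding L_def by (simp add: field_simps)
  also have "(b - 1) / b * L \<le> (b - 1) / b * ((1 - \<bar>z\<bar>) / 2)"
    using L b by (intro mult_left_mono) auto
  also have "\<dots> \<le> 1/2 - \<bar>z\<bar> / 4"
  proof -
    define c where "c = (b - 1) / b"
    have c: "c \<le> 1" "1/2 \<le> c" using b by (auto simp: c_def field_simps)
    then have "1/2 * \<bar>z\<bar> \<le> c * \<bar>z\<bar>" by (intro mult_right_mono) auto
    moreover define w where "w = c * \<bar>z\<bar>"
    ultimately have "(c - w) / 2 \<le> 1/2 - \<bar>z\<bar> / 4"
      using c by simp
    moreover have "c * ((1 - \<bar>z\<bar>) / 2) = (c - w) / 2"
      by (simp add: right_diff_distrib w_def)
    ultimately show ?thesis
      by (simp only: c_def)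
  qed
  finally have "(b - 1) * ln (1 + z / sqrt b) - sqrt b * z \<le> 1/2 + - \<bar>z\<bar> / 8"
    using \<open>\<bar>z / sqrt b\<bar> \<le> \<bar>z\<bar> / 8\<close> by linarith
  then show ?thesis
    using True by (simp add: gamma_kernel_def exp_add[symmetric])
qed

text \<open>Expanding the logarithm to second order, the linear term cancels
  \<open>sqrt b * z\<close>, the quadratic one gives \<open>- z^2 / 2\<close>, and the rest is of
  order \<open>1 / sqrt b\<close>.\<close>

lemma gamma_kernel_tendsto: "((\<lambda>b. gamma_kernel b z) \<longlongrightarrow> exp (- z\<^sup>2 / 2)) at_top"
proof -
  have "((\<lambda>b. (b - 1) * ln (1 + z / sqrt b) - sqrt b * z) \<longlongrightarrow> - z\<^sup>2 / 2) at_top"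
  \<comment> \<open>The sign of \<open>z\<close> is fixed so that the leading coefficient of the
    expansion has a known sign.\<close>
  proof (cases z "0 :: real" rule: linorder_cases)
    case less
    then show ?thesis by real_asymp (simp add: power2_eq_square)
  next
    case greater
    then show ?thesis by real_asymp (simp add: power2_eq_square)
  qed simp
  then have "((\<lambda>b. exp ((b - 1) * ln (1 + z / sqrt b) - sqrt b * z)) \<longlongrightarrow> exp (- z\<^sup>2 / 2)) at_top"
    by (rule tendsto_exp)
  moreover have "((\<lambda>b. 1 / sqrt b) \<longlongrightarrow> 0) at_top"
    by real_asymp
  then have "((\<lambda>b. 1 + z * (1 / sqrt b)) \<longlongrightarrow> 1 + z * 0) at_top"
    by (intro tendsto_intros)
  from order_tendstoD(1)[OF this, of 0] have "\<forall>\<^sub>F b in at_top. 0 < 1 + z / sqrt b" by simp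
  then have "\<forall>\<^sub>F b in at_top. exp ((b - 1) * ln (1 + z / sqrt b) - sqrt b * z) = gamma_kernel b z"
    by eventually_elim (simp add: gamma_kernel_def)
  ultimately show ?thesis
    by (rule Lim_transform_eventually)
qed

text \<open>Up to the factor \<open>l\<close>, an exponential density and its mirror image together
  dominate the two-sided exponential.\<close>

lemma integrable_exp_minus_abs:
  assumes "0 < l"
  shows "integrable lborel (\<lambda>z::real. exp (- l * \<bar>z\<bar>))"
proof -
  have 1: "integrable lborel (exponential_density l)"
  proof (rule integrableI_nonneg)
    interpret prob_space "density lborel (\<lambda>x. ennreal (exponential_density l x))"
      by (rule prob_space_exponential_density) fact
    show "(\<integral>\<^sup>+x. ennreal (exponential_density l x) \<partial>lborel) < \<infinity>"
      using emeasure_space_1 by (simp add: emeasure_density)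
  qed (use exponential_density_nonneg[OF assms] in auto)
  have 2: "integrable lborel (\<lambda>x. exponential_density l (0 + (-1) * x))"
    by (rule lborel_integrable_real_affine[OF 1]) simp
  show ?thesis
  proof (rule Bochner_Integration.integrable_bound)
    show "integrable lborel (\<lambda>x. (exponential_density l x + exponential_density l (0 + (-1) * x)) / l)"
      by (intro integrable_divide Bochner_Integration.integrable_add 1 2)
    show "AE x in lborel. norm (exp (- l * \<bar>x\<bar>))
        \<le> norm ((exponential_density l x + exponential_density l (0 + (-1) * x)) / l)"
      using assms by (intro AE_I2) (auto simp: exponential_density_def)
  qed measurable
qed

text \<open>Stirling's formula. Since the standardised density has total mass 1, its constant is the
  reciprocal of the integral of the kernel, and that integral tends to the Gaussian one,
  \<open>sqrt (2 * pi)\<close>, by dominated convergence.\<close>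

lemma gamma_normalizer_tendsto:
  "((\<lambda>b. b powr (b - 1/2) * exp (- b) / Gamma b) \<longlongrightarrow> 1 / sqrt (2 * pi)) at_top"
proof -
  have lim: "((\<lambda>b. \<integral>z. gamma_kernel b z \<partial>lborel) \<longlongrightarrow> (\<integral>z. exp (- z\<^sup>2 / 2) \<partial>lborel)) at_top"
  proof (rule integral_dominated_convergence_at_top)
    show "integrable lborel (\<lambda>z::real. exp (1/2) * exp (- (1/8) * \<bar>z\<bar>))"
      by (intro integrable_mult_right integrable_exp_minus_abs) simp
    show "\<forall>\<^sub>F b in at_top. AE z in lborel. norm (gamma_kernel b z) \<le> exp (1/2) * exp (- (1/8) * \<bar>z\<bar>)"
      using eventually_ge_at_top[of 64]
    proof eventually_elim
      case (elim b)
      then show ?case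
        using gamma_kernel_bound[OF elim] gamma_kernel_nonneg by (intro AE_I2) simp
    qed
  qed (use gamma_kernel_tendsto in auto)
  have "(\<integral>z. std_normal_density z * sqrt (2 * pi) \<partial>lborel) = sqrt (2 * pi)"
    by simp
  then have I: "(\<integral>z. exp (- z\<^sup>2 / 2) \<partial>lborel) = sqrt (2 * pi)"
    by (simp add: std_normal_density_def)
  have "((\<lambda>b. 1 / (\<integral>z. gamma_kernel b z \<partial>lborel)) \<longlongrightarrow> 1 / sqrt (2 * pi)) at_top"
    by (intro tendsto_intros lim[unfolded I]) simp
  moreover have "\<forall>\<^sub>F b in at_top. 1 / (\<integral>z. gamma_kernel b z \<partial>lborel) = b powr (b - 1/2) * exp (- b) / Gamma b"
    using eventually_gt_at_top[of 0]
  proof eventually_elim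
    case (elim b)
    interpret prob_space "density lborel (\<lambda>z. ennreal (std_gamma_density b z))"
      by (rule prob_space_std_gamma) fact
    have "1 = (\<integral>z. (1::real) \<partial>density lborel (\<lambda>z. ennreal (std_gamma_density b z)))"
      using prob_space by simp
    also have "\<dots> = (\<integral>z. std_gamma_density b z \<partial>lborel)"
      using std_gamma_density_nonneg[OF elim] by (subst integral_density) auto
    also have "\<dots> = (b powr (b - 1/2) * exp (- b) / Gamma b) * (\<integral>z. gamma_kernel b z \<partial>lborel)"
      unfolding std_gamma_density_eq[OF elim] by simp
    finally show ?case
      by (metis divide_eq_eq mult_zero_right zero_neq_one)
  qed
  ultimately show ?thesis
    by (rule Lim_transform_eventually)
qed

lemma std_gamma_density_tendsto:
  "((\<lambda>b. std_gamma_density b z) \<longlongrightarrow> std_normal_density z) at_top"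
proof (rule Lim_transform_eventually)
  show "((\<lambda>b. (b powr (b - 1/2) * exp (- b) / Gamma b) * gamma_kernel b z) \<longlongrightarrow> std_normal_density z) at_top"
    unfolding std_normal_density_def by (intro tendsto_mult gamma_normalizer_tendsto gamma_kernel_tendsto)
  show "\<forall>\<^sub>F b in at_top. (b powr (b - 1/2) * exp (- b) / Gamma b) * gamma_kernel b z = std_gamma_density b z"
    using eventually_gt_at_top[of 0] by eventually_elim (simp only: std_gamma_density_eq)
qed

text \<open>The normalising constant has the limit \<open>1 / sqrt (2 * pi) < 1\<close>, so it is
  eventually below 1 and the majorant of the kernel carries over with the same constants.\<close>

lemma std_gamma_density_bound:
  "\<forall>\<^sub>F b in at_top. \<forall>z. std_gamma_density b z \<le> exp (1/2) * exp (- (1/8) * \<bar>z\<bar>)"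
proof -
  have "1 / sqrt (2 * pi) < 1"
    using pi_gt3 by simp
  from order_tendstoD(2)[OF gamma_normalizer_tendsto this] eventually_ge_at_top[of 64]
  show ?thesis
  proof eventually_elim
    case (elim b)
    show ?case
    proof
      fix z
      have "std_gamma_density b z \<le> 1 * gamma_kernel b z"
        using elim unfolding std_gamma_density_eq[OF order.strict_trans2[OF _ elim(2), of 0, simplified]]
        by (intro mult_right_mono gamma_kernel_nonneg) auto
      also have "\<dots> \<le> exp (1/2) * exp (- (1/8) * \<bar>z\<bar>)"
        using gamma_kernel_bound[OF elim(2), of z] by simp
      finally show "std_gamma_density b z \<le> exp (1/2) * exp (- (1/8) * \<bar>z\<bar>)" .
    qed
  qed
qed

section \<open>Product densities and convergence in total variation\<close>

lemma PiM_density: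
  assumes I: "finite I"
    and sf: "\<And>i. sigma_finite_measure (M i)" "\<And>i. i \<in> I \<Longrightarrow> sigma_finite_measure (density (M i) (f i))"
    and f: "\<And>i. i \<in> I \<Longrightarrow> f i \<in> borel_measurable (M i)"
  shows "PiM I (\<lambda>i. density (M i) (f i)) = density (PiM I M) (\<lambda>x. \<Prod>i\<in>I. f i (x i))"
proof -
  \<comment> \<open>Nothing is assumed about \<open>f\<close> outside \<open>I\<close>, whereas a
    sigma-finite product family needs every index; the density 1 fills the gap.\<close>
  define g where "g i = (if i \<in> I then f i else (\<lambda>_. 1))" for i
  have g [measurable]: "g i \<in> borel_measurable (M i)" for i
    using f by (simp add: g_def)
  interpret M: product_sigma_finite M
    using sf(1) by (simp add: product_sigma_finite_def)
  interpret D: product_sigma_finite "\<lambda>i. density (M i) (g i)"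
    using sf by (auto simp: product_sigma_finite_def g_def density_1)
  have [measurable]: "(\<lambda>x. \<Prod>i\<in>I. g i (x i)) \<in> borel_measurable (PiM I M)"
    by measurable
  have "density (PiM I M) (\<lambda>x. \<Prod>i\<in>I. g i (x i)) = PiM I (\<lambda>i. density (M i) (g i))"
  proof (rule D.PiM_eqI[OF I])
    show "sets (density (PiM I M) (\<lambda>x. \<Prod>i\<in>I. g i (x i))) = sets (PiM I (\<lambda>i. density (M i) (g i)))"
      by (simp cong: sets_PiM_cong)
    fix A assume "\<And>i. i \<in> I \<Longrightarrow> A i \<in> sets (density (M i) (g i))"
    then have A [measurable]: "A i \<in> sets (M i)" if "i \<in> I" for i
      using that by simp
    have "emeasure (density (PiM I M) (\<lambda>x. \<Prod>i\<in>I. g i (x i))) (Pi\<^sub>E I A)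
       = (\<integral>\<^sup>+x. (\<Prod>i\<in>I. g i (x i)) * indicator (Pi\<^sub>E I A) x \<partial>PiM I M)"
      using I by (subst emeasure_density) (auto intro!: sets_PiM_I_finite)
    also have "\<dots> = (\<integral>\<^sup>+x. (\<Prod>i\<in>I. g i (x i) * indicator (A i) (x i)) \<partial>PiM I M)"
    proof (intro nn_integral_cong)
      fix x assume "x \<in> space (PiM I M)"
      then have "x \<in> extensional I" by (auto simp: space_PiM PiE_def)
      then have "indicator (Pi\<^sub>E I A) x = (\<Prod>i\<in>I. indicator (A i) (x i) :: ennreal)"
        using I by (auto simp: indicator_def PiE_def Pi_def prod_zero_iff)
      then show "(\<Prod>i\<in>I. g i (x i)) * indicator (Pi\<^sub>E I A) x = (\<Prod>i\<in>I. g i (x i) * indicator (A i) (x i))"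
        by (simp add: prod.distrib)
    qed
    also have "\<dots> = (\<Prod>i\<in>I. \<integral>\<^sup>+x. g i x * indicator (A i) x \<partial>M i)"
      by (rule M.product_nn_integral_prod[OF I]) auto
    also have "\<dots> = (\<Prod>i\<in>I. emeasure (density (M i) (g i)) (A i))"
      by (intro prod.cong refl) (simp add: emeasure_density)
    finally show "emeasure (density (PiM I M) (\<lambda>x. \<Prod>i\<in>I. g i (x i))) (Pi\<^sub>E I A)
       = (\<Prod>i\<in>I. emeasure (density (M i) (g i)) (A i))" .
  qed
  also have "PiM I (\<lambda>i. density (M i) (g i)) = PiM I (\<lambda>i. density (M i) (f i))"
    by (intro PiM_cong) (auto simp: g_def)
  also have "(\<lambda>x. \<Prod>i\<in>I. g i (x i)) = (\<lambda>x. \<Prod>i\<in>I. f i (x i))"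
    by (intro ext prod.cong) (auto simp: g_def)
  finally show ?thesis ..
qed

lemma PiM_real_density:
  fixes f :: "'i \<Rightarrow> real \<Rightarrow> real"
  assumes "finite I"
    and "\<And>i. i \<in> I \<Longrightarrow> prob_space (density lborel (\<lambda>x. ennreal (f i x)))"
    and "\<And>i. i \<in> I \<Longrightarrow> f i \<in> borel_measurable borel" "\<And>i x. i \<in> I \<Longrightarrow> 0 \<le> f i x"
  shows "PiM I (\<lambda>i. density lborel (\<lambda>x. ennreal (f i x)))
     = density (PiM I (\<lambda>_. lborel)) (\<lambda>x. ennreal (\<Prod>i\<in>I. f i (x i)))"
proof -
  have "PiM I (\<lambda>i. density lborel (\<lambda>x. ennreal (f i x)))
     = density (PiM I (\<lambda>_. lborel)) (\<lambda>x. \<Prod>i\<in>I. ennreal (f i (x i)))"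
    using assms by (intro PiM_density) (auto intro: prob_space_imp_sigma_finite lborel.sigma_finite_measure_axioms)
  then show ?thesis
    using assms by (simp add: prod_ennreal)
qed

lemma measure_density_eq_integral:
  fixes g :: "'a \<Rightarrow> real"
  assumes [measurable]: "g \<in> borel_measurable M" "E \<in> sets M" and "\<And>x. 0 \<le> g x"
  shows "measure (density M (\<lambda>x. ennreal (g x))) E = (\<integral>x. g x * indicator E x \<partial>M)"
proof -
  have "measure (density M (\<lambda>x. ennreal (g x))) E = (\<integral>x. indicator E x \<partial>density M (\<lambda>x. ennreal (g x)))"
    using sets.sets_into_space[OF assms(2)] by (simp add: Int_absorb2)
  also have "\<dots> = (\<integral>x. g x *\<^sub>R indicator E x \<partial>M)"
    using assms by (intro integral_density) auto
  finally show ?thesis by simp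
qed

abbreviation std_gamma_PiM :: "nat \<Rightarrow> (nat \<Rightarrow> real) \<Rightarrow> (nat \<Rightarrow> real) measure" where
  "std_gamma_PiM k b \<equiv> PiM {..<k} (\<lambda>i. density lborel (\<lambda>z. ennreal (std_gamma_density (b i) z)))"

abbreviation std_normal_PiM :: "nat \<Rightarrow> (nat \<Rightarrow> real) measure" where
  "std_normal_PiM k \<equiv> PiM {..<k} (\<lambda>_. std_normal)"

text \<open>Scheffe's argument: the product densities converge pointwise below the integrable
  product majorant \<open>W\<close>, so their L1 distance tends to 0, and it bounds the difference
  of the measures on any event. Hence \<open>E\<close> may vary with \<open>m\<close>.\<close>

lemma std_gamma_PiM_tv:
  fixes b :: "nat \<Rightarrow> nat \<Rightarrow> real"
  assumes b: "\<And>i. i < k \<Longrightarrow> filterlim (\<lambda>m. b m i) at_top sequentially"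
    and E: "\<And>m. E m \<in> sets (PiM {..<k} (\<lambda>_. borel))"
  shows "(\<lambda>m. measure (std_gamma_PiM k (b m)) (E m) - measure (std_normal_PiM k) (E m)) \<longlonglongrightarrow> 0"
proof -
  let ?L = "PiM {..<k} (\<lambda>_::nat. lborel :: real measure)"
  define W where "W x = (\<Prod>i<k. exp (1/2) * exp (- (1/8) * \<bar>x i\<bar>))" for x :: "nat \<Rightarrow> real"
  define g where "g m x = (\<Prod>i<k. std_gamma_density (b m i) (x i))" for m x
  define n where "n x = (\<Prod>i<k. std_normal_density (x i))" for x :: "nat \<Rightarrow> real"
  interpret L: product_sigma_finite "\<lambda>_::nat. lborel :: real measure" ..
  have [measurable]: "E m \<in> sets ?L" for m
    using E[of m] by (simp cong: sets_PiM_cong)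
  have [measurable]: "g m \<in> borel_measurable ?L" "n \<in> borel_measurable ?L" for m
    unfolding g_def n_def by measurable
  have W: "integrable ?L W"
    unfolding W_def
    by (intro L.product_integrable_prod integrable_mult_right integrable_exp_minus_abs) auto
  have n0: "0 \<le> n x" for x
    by (auto simp: n_def intro!: prod_nonneg)
  have "\<forall>\<^sub>F m in sequentially. \<forall>i\<in>{..<k}. 0 < b m i \<and>
      (\<forall>z. std_gamma_density (b m i) z \<le> exp (1/2) * exp (- (1/8) * \<bar>z\<bar>))"
  proof (intro eventually_ball_finite ballI eventually_conj)
    fix i assume "i \<in> {..<k}"
    then have i: "filterlim (\<lambda>m. b m i) at_top sequentially" using b by simp
    show "\<forall>\<^sub>F m in sequentially. 0 < b m i"
      using i by (simp add: filterlim_at_top_dense)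
    show "\<forall>\<^sub>F m in sequentially. \<forall>z. std_gamma_density (b m i) z \<le> exp (1/2) * exp (- (1/8) * \<bar>z\<bar>)"
      using eventually_compose_filterlim[OF std_gamma_density_bound i] .
  qed simp
  then obtain N where N: "\<And>m i. m \<ge> N \<Longrightarrow> i < k \<Longrightarrow> 0 < b m i"
     "\<And>m i z. m \<ge> N \<Longrightarrow> i < k \<Longrightarrow> std_gamma_density (b m i) z \<le> exp (1/2) * exp (- (1/8) * \<bar>z\<bar>)"
    by (auto simp: eventually_sequentially)
  have g0: "0 \<le> g m x" and gW: "g m x \<le> W x" if "m \<ge> N" for m x
    unfolding g_def W_def using N[OF that]
    by (auto intro!: prod_nonneg prod_mono std_gamma_density_nonneg)
  have lim: "(\<lambda>m. g m x) \<longlonglongrightarrow> n x" for x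
    unfolding g_def n_def
    by (intro tendsto_prod filterlim_compose[OF std_gamma_density_tendsto b]) auto
  \<comment> \<open>The limit density inherits the majorant.\<close>
  have nW: "n x \<le> W x" for x
    using gW by (intro LIMSEQ_le_const2[OF lim]) auto
  have gi: "integrable ?L (g m)" if "m \<ge> N" for m
    using g0[OF that] gW[OF that] by (intro Bochner_Integration.integrable_bound[OF W]) (auto intro!: AE_I2 order.trans[OF _ abs_ge_self])
  have ni: "integrable ?L n"
    using n0 nW by (intro Bochner_Integration.integrable_bound[OF W]) (auto intro!: AE_I2 order.trans[OF _ abs_ge_self])
  \<comment> \<open>The majorant holds only from index \<open>N\<close> on, hence the shift, which
    is undone at the end.\<close>
  have dist: "(\<lambda>m. \<integral>x. \<bar>g (m + N) x - n x\<bar> \<partial>?L) \<longlonglongrightarrow> (\<integral>x. 0 \<partial>?L)"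
  proof (rule integral_dominated_convergence[OF _ _ W])
    show "AE x in ?L. (\<lambda>m. \<bar>g (m + N) x - n x\<bar>) \<longlonglongrightarrow> 0"
    proof (rule AE_I2)
      fix x
      have "(\<lambda>m. \<bar>g (m + N) x - n x\<bar>) \<longlonglongrightarrow> \<bar>n x - n x\<bar>"
        by (intro tendsto_intros LIMSEQ_ignore_initial_segment lim)
      then show "(\<lambda>m. \<bar>g (m + N) x - n x\<bar>) \<longlonglongrightarrow> 0" by simp
    qed
    show "AE x in ?L. norm \<bar>g (m + N) x - n x\<bar> \<le> W x" for m
    proof (rule AE_I2)
      fix x
      show "norm \<bar>g (m + N) x - n x\<bar> \<le> W x"
        using g0[of "m + N" x] gW[of "m + N" x] n0[of x] nW[of x] by (simp add: abs_le_iff)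
    qed
  qed auto
  have "(\<lambda>m. measure (std_gamma_PiM k (b (m + N))) (E (m + N)) - measure (std_normal_PiM k) (E (m + N))) \<longlonglongrightarrow> 0"
  proof (rule Lim_null_comparison)
    show "(\<lambda>m. \<integral>x. \<bar>g (m + N) x - n x\<bar> \<partial>?L) \<longlonglongrightarrow> 0"
      using dist by simp
    show "\<forall>\<^sub>F m in sequentially. norm (measure (std_gamma_PiM k (b (m + N))) (E (m + N)) - measure (std_normal_PiM k) (E (m + N)))
        \<le> (\<integral>x. \<bar>g (m + N) x - n x\<bar> \<partial>?L)"
    proof (intro always_eventually allI)
      fix m
      define M where "M = m + N"
      then have M: "M \<ge> N" by simp
      have G: "std_gamma_PiM k (b M) = density ?L (\<lambda>x. ennreal (g M x))"
        unfolding g_def using N(1)[OF M]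
        by (intro PiM_real_density) (auto intro: prob_space_std_gamma std_gamma_density_nonneg)
      have Nn: "std_normal_PiM k = density ?L (\<lambda>x. ennreal (n x))"
        unfolding n_def by (intro PiM_real_density) (auto intro: prob_space_std_normal)
      have "measure (std_gamma_PiM k (b M)) (E M) - measure (std_normal_PiM k) (E M)
        = (\<integral>x. g M x * indicator (E M) x \<partial>?L) - (\<integral>x. n x * indicator (E M) x \<partial>?L)"
        unfolding G Nn using g0[OF M] n0 by (subst (1 2) measure_density_eq_integral) auto
      also have "\<dots> = (\<integral>x. g M x * indicator (E M) x - n x * indicator (E M) x \<partial>?L)"
        by (intro Bochner_Integration.integral_diff[symmetric] integrable_real_mult_indicator gi ni M) auto
      also have "norm \<dots> \<le> (\<integral>x. norm (g M x * indicator (E M) x - n x * indicator (E M) x) \<partial>?L)"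
        by (rule Bochner_Integration.integral_norm_bound)
      also have "\<dots> \<le> (\<integral>x. \<bar>g M x - n x\<bar> \<partial>?L)"
        by (intro integral_mono integrable_abs integrable_norm Bochner_Integration.integrable_diff
            integrable_real_mult_indicator gi ni M) (auto simp: indicator_def)
      finally show "norm (measure (std_gamma_PiM k (b (m + N))) (E (m + N)) - measure (std_normal_PiM k) (E (m + N)))
        \<le> (\<integral>x. \<bar>g (m + N) x - n x\<bar> \<partial>?L)" by (simp only: M_def)
    qed
  qed
  then show ?thesis by (rule LIMSEQ_offset)
qed

section \<open>Pointwise asymptotics of the statistics\<close>

text \<open>The statistic as a function of the vector \<open>P\<close> of cell probabilities and the
  Dirichlet weights \<open>b\<close> alone: the concentration is the total weight \<open>a\<close>,
  and \<open>b i / a\<close> is the base probability of cell \<open>i\<close>.\<close>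

definition chi_form :: "nat \<Rightarrow> (nat \<Rightarrow> real) \<Rightarrow> (nat \<Rightarrow> real) \<Rightarrow> real" where
  "chi_form k b P = (let a = (\<Sum>i<k. b i) in a * (\<Sum>i<k. (P i - b i / a)\<^sup>2 / (b i / a)))"

definition KL_form :: "nat \<Rightarrow> (nat \<Rightarrow> real) \<Rightarrow> (nat \<Rightarrow> real) \<Rightarrow> real" where
  "KL_form k b P = (let a = (\<Sum>i<k. b i) in 2 * a * (\<Sum>i<k. P i * ln (P i / (b i / a))))"

text \<open>For positive weights, the squared length of the part of \<open>z\<close> orthogonal to
  the unit vector of the square roots of the base probabilities.\<close>

definition normal_form :: "nat \<Rightarrow> (nat \<Rightarrow> real) \<Rightarrow> (nat \<Rightarrow> real) \<Rightarrow> real" where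
  "normal_form k b z = (\<Sum>i<k. (z i)\<^sup>2) - (\<Sum>i<k. sqrt (b i / (\<Sum>j<k. b j)) * z i)\<^sup>2"

definition normalized :: "nat \<Rightarrow> (nat \<Rightarrow> real) \<Rightarrow> nat \<Rightarrow> real" where
  "normalized k g i = g i / (\<Sum>j<k. g j)"

definition unstandardize :: "(nat \<Rightarrow> real) \<Rightarrow> (nat \<Rightarrow> real) \<Rightarrow> nat \<Rightarrow> real" where
  "unstandardize b z i = b i + sqrt (b i) * z i"

text \<open>An exact identity: passing from the chi-square statistic to the normal form costs only
  the squared ratio of the total weight to the total of the unstandardised coordinates.\<close>

lemma chi_form_normalized:
  fixes b z :: "nat \<Rightarrow> real"
  assumes b: "\<And>i. i < k \<Longrightarrow> 0 < b i" and k: "0 < k"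
    and S: "(\<Sum>i<k. unstandardize b z i) \<noteq> 0"
  shows "chi_form k b (normalized k (unstandardize b z))
    = ((\<Sum>i<k. b i) / (\<Sum>i<k. unstandardize b z i))\<^sup>2 * normal_form k b z"
proof -
  define a where "a = (\<Sum>i<k. b i)"
  define s where "s = (\<Sum>i<k. unstandardize b z i)"
  define T where "T = (\<Sum>i<k. sqrt (b i) * z i)"
  have a: "0 < a" unfolding a_def using b k by (intro sum_pos) auto
  have s: "s = a + T" by (simp add: s_def a_def T_def unstandardize_def sum.distrib)
  have s0: "s \<noteq> 0" using S by (simp add: s_def)
  have summand: "a * ((unstandardize b z i / s - b i / a)\<^sup>2 / (b i / a))
     = (a / s)\<^sup>2 * ((z i)\<^sup>2 - 2 * T / a * (sqrt (b i) * z i) + (T / a)\<^sup>2 * b i)" if i: "i < k" for i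
  proof -
    have bi: "0 < b i" using b i by simp
    define r where "r = sqrt (b i)"
    have r: "0 < r" "b i = r\<^sup>2" using bi by (simp_all add: r_def)
    \<comment> \<open>Random normalisation is what subtracts the projection:
      \<open>s = a + T\<close> turns the centred cell into \<open>z i\<close> minus a multiple of
      \<open>T\<close>.\<close>
    have "unstandardize b z i / s - b i / a = (r / s) * (z i - r * T / a)"
      unfolding unstandardize_def r_def[symmetric] unfolding r(2) s
      using s0[unfolded s] a by (simp add: field_simps power2_eq_square)
    then have "a * ((unstandardize b z i / s - b i / a)\<^sup>2 / (b i / a)) = a * (((r / s) * (z i - r * T / a))\<^sup>2 / (r\<^sup>2 / a))"
      unfolding r(2) by simp
    also have "\<dots> = (a / s)\<^sup>2 * (z i - r * T / a)\<^sup>2"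
      using r(1) a by (simp add: power_mult_distrib power_divide power2_eq_square)
    also have "(z i - r * T / a)\<^sup>2 = (z i)\<^sup>2 - 2 * T / a * (r * z i) + (T / a)\<^sup>2 * r\<^sup>2"
      by (simp add: power2_diff power_divide power_mult_distrib mult_ac)
    finally show ?thesis unfolding r_def[symmetric] unfolding r(2) .
  qed
  have "chi_form k b (normalized k (unstandardize b z)) = (\<Sum>i<k. a * ((unstandardize b z i / s - b i / a)\<^sup>2 / (b i / a)))"
    by (simp add: chi_form_def normalized_def a_def[symmetric] s_def[symmetric] sum_distrib_left)
  also have "\<dots> = (\<Sum>i<k. (a / s)\<^sup>2 * ((z i)\<^sup>2 - 2 * T / a * (sqrt (b i) * z i) + (T / a)\<^sup>2 * b i))"
    by (intro sum.cong summand) auto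
  also have "\<dots> = (a / s)\<^sup>2 * ((\<Sum>i<k. (z i)\<^sup>2) - 2 * T / a * T + (T / a)\<^sup>2 * a)"
    by (simp only: sum_distrib_left[symmetric] sum.distrib sum_subtractf T_def[symmetric] a_def[symmetric])
  also have "- 2 * T / a * T + (T / a)\<^sup>2 * a = - (T\<^sup>2 / a)"
    using a by (simp add: power2_eq_square field_simps)
  then have "(\<Sum>i<k. (z i)\<^sup>2) - 2 * T / a * T + (T / a)\<^sup>2 * a = (\<Sum>i<k. (z i)\<^sup>2) - T\<^sup>2 / a"
    by simp
  also have "T\<^sup>2 / a = (\<Sum>i<k. sqrt (b i / a) * z i)\<^sup>2"
  proof -
    have "(\<Sum>i<k. sqrt (b i / a) * z i) = T / sqrt a"
      by (simp add: T_def sum_divide_distrib real_sqrt_divide)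
    then show ?thesis using a by (simp add: power_divide)
  qed
  finally show ?thesis
    by (simp only: normal_form_def a_def s_def)
qed

text \<open>Each coefficient of the projection is at most 1. The bound is free of \<open>b\<close>,
  so at fixed \<open>z\<close> the form stays bounded while the weights move.\<close>

lemma normal_form_bounded:
  assumes b: "\<And>i. i < k \<Longrightarrow> 0 < b i"
  shows "\<bar>normal_form k b z\<bar> \<le> (\<Sum>i<k. (z i)\<^sup>2) + (\<Sum>i<k. \<bar>z i\<bar>)\<^sup>2"
proof -
  have "\<bar>\<Sum>i<k. sqrt (b i / (\<Sum>j<k. b j)) * z i\<bar> \<le> (\<Sum>i<k. \<bar>z i\<bar>)"
  proof (rule order.trans[OF sum_abs sum_mono])
    fix i assume "i \<in> {..<k}"
    then have i: "i < k" by simp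
    have "b i \<le> (\<Sum>j<k. b j)"
      using b i by (intro member_le_sum) (auto intro: less_imp_le)
    then have "sqrt (b i / (\<Sum>j<k. b j)) \<le> 1" "0 \<le> sqrt (b i / (\<Sum>j<k. b j))"
      using b[OF i] by (auto simp: divide_le_eq_1)
    then show "\<bar>sqrt (b i / (\<Sum>j<k. b j)) * z i\<bar> \<le> \<bar>z i\<bar>"
      by (simp add: abs_mult mult_left_le_one_le)
  qed
  then have "(\<Sum>i<k. sqrt (b i / (\<Sum>j<k. b j)) * z i)\<^sup>2 \<le> (\<Sum>i<k. \<bar>z i\<bar>)\<^sup>2"
    by (simp add: abs_le_square_iff sum_nonneg abs_of_nonneg flip: abs_le_square_iff)
  moreover have "0 \<le> (\<Sum>i<k. (z i)\<^sup>2)" "0 \<le> (\<Sum>i<k. sqrt (b i / (\<Sum>j<k. b j)) * z i)\<^sup>2"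
    by (auto intro: sum_nonneg)
  ultimately show ?thesis
    unfolding normal_form_def by linarith
qed

lemma tendsto_0_mult_bounded:
  fixes f g :: "nat \<Rightarrow> real"
  assumes "f \<longlonglongrightarrow> 0" "\<forall>\<^sub>F m in sequentially. \<bar>g m\<bar> \<le> C"
  shows "(\<lambda>m. f m * g m) \<longlonglongrightarrow> 0"
proof (rule Lim_null_comparison)
  show "(\<lambda>m. \<bar>f m\<bar> * C) \<longlonglongrightarrow> 0"
    using tendsto_mult_left_zero[OF tendsto_rabs_zero[OF assms(1)]] .
  show "\<forall>\<^sub>F m in sequentially. norm (f m * g m) \<le> \<bar>f m\<bar> * C"
    using assms(2) by eventually_elim (auto simp: abs_mult intro: mult_left_mono)
qed

text \<open>The relative error of the second-order Taylor expansion of \<open>2 (1 + t) ln (1 + t)\<close>; at \<open>t = 0\<close>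
  the division by zero yields the correct limit \<open>0\<close>.\<close>

definition taylor_error :: "real \<Rightarrow> real" where
  "taylor_error t = (2 * (1 + t) * ln (1 + t) - 2 * t - t\<^sup>2) / t\<^sup>2"

lemma isCont_taylor_error: "isCont taylor_error 0"
proof -
  have "taylor_error \<midarrow>0\<rightarrow> 0"
    unfolding taylor_error_def by real_asymp
  then show ?thesis by (simp add: isCont_def taylor_error_def)
qed

section \<open>Limits at a fixed vector \<open>z\<close> as all weights diverge\<close>

locale diverging_weights =
  fixes k :: nat and b :: "nat \<Rightarrow> nat \<Rightarrow> real"
  assumes k: "0 < k"
    and b: "\<And>i. i < k \<Longrightarrow> filterlim (\<lambda>m. b m i) at_top sequentially"
begin

definition total :: "nat \<Rightarrow> real" where
  "total m = (\<Sum>i<k. b m i)"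

definition gtotal :: "nat \<Rightarrow> (nat \<Rightarrow> real) \<Rightarrow> real" where
  "gtotal m z = (\<Sum>i<k. unstandardize (b m) z i)"

lemma eventually_b_pos: "\<forall>\<^sub>F m in sequentially. \<forall>i\<in>{..<k}. 0 < b m i"
  using b by (intro eventually_ball_finite) (auto simp: filterlim_at_top_dense)

lemma total_pos:
  assumes "\<forall>i\<in>{..<k}. 0 < b m i"
  shows "0 < total m" and "i < k \<Longrightarrow> b m i \<le> total m"
proof -
  show "0 < total m"
    unfolding total_def using assms k by (intro sum_pos) auto
  show "b m i \<le> total m" if "i < k"
    unfolding total_def using assms that by (intro member_le_sum) (auto intro: less_imp_le)
qed

text \<open>The relative fluctuation is a sum of terms \<open>sqrt (b m i) * z i / total m\<close>,
  each at most \<open>\<bar>z i\<bar> / sqrt (b m i)\<close> in absolute value because a weight is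
  at most the total.\<close>

lemma gtotal_ratio: "(\<lambda>m. total m / gtotal m z) \<longlonglongrightarrow> 1"
proof -
  have "(\<lambda>m. \<Sum>i<k. sqrt (b m i) * z i / total m) \<longlonglongrightarrow> (\<Sum>i<k. 0)"
  proof (rule tendsto_sum)
    fix i assume "i \<in> {..<k}"
    then have i: "i < k" by simp
    show "(\<lambda>m. sqrt (b m i) * z i / total m) \<longlonglongrightarrow> 0"
    proof (rule Lim_null_comparison)
      have "(\<lambda>m. inverse (sqrt (b m i))) \<longlonglongrightarrow> 0"
        by (intro tendsto_inverse_0_at_top filterlim_compose[OF sqrt_at_top b] i)
      then show "(\<lambda>m. inverse (sqrt (b m i)) * \<bar>z i\<bar>) \<longlonglongrightarrow> 0"
        by (rule tendsto_mult_left_zero)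
      show "\<forall>\<^sub>F m in sequentially. norm (sqrt (b m i) * z i / total m) \<le> inverse (sqrt (b m i)) * \<bar>z i\<bar>"
        using eventually_b_pos
      proof eventually_elim
        case (elim m)
        have bi: "0 < b m i" using elim i by simp
        have "sqrt (b m i) / total m \<le> sqrt (b m i) / b m i"
          using bi total_pos[OF elim] i by (intro divide_left_mono) auto
        also have "\<dots> = inverse (sqrt (b m i))"
          using bi by (intro sqrt_divide_self_eq) simp
        finally have "sqrt (b m i) / total m * \<bar>z i\<bar> \<le> inverse (sqrt (b m i)) * \<bar>z i\<bar>"
          by (intro mult_right_mono) auto
        then show ?case
          using bi total_pos(1)[OF elim] by (simp add: abs_mult abs_divide)
      qed
    qed
  qed
  then have "(\<lambda>m. inverse (1 + (\<Sum>i<k. sqrt (b m i) * z i / total m))) \<longlonglongrightarrow> inverse (1 + 0)"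
    by (intro tendsto_intros) simp_all
  moreover have "\<forall>\<^sub>F m in sequentially. inverse (1 + (\<Sum>i<k. sqrt (b m i) * z i / total m)) = total m / gtotal m z"
    using eventually_b_pos
  proof eventually_elim
    case (elim m)
    have "gtotal m z = total m + (\<Sum>i<k. sqrt (b m i) * z i)"
      by (simp add: gtotal_def total_def unstandardize_def sum.distrib)
    also have "\<dots> = total m * (1 + (\<Sum>i<k. sqrt (b m i) * z i / total m))"
      using total_pos(1)[OF elim] by (simp add: distrib_left sum_distrib_left)
    finally show ?case
      using total_pos(1)[OF elim] by (simp add: inverse_eq_divide)
  qed
  ultimately have "(\<lambda>m. total m / gtotal m z) \<longlonglongrightarrow> inverse (1 + 0)"
    by (rule Lim_transform_eventually)
  then show ?thesis by simp
qed

text \<open>A quotient by 0 is 0, so a ratio that tends to 1 excludes a zero denominator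
  eventually.\<close>

lemma gtotal_nonzero: "\<forall>\<^sub>F m in sequentially. gtotal m z \<noteq> 0"
proof -
  have "\<forall>\<^sub>F m in sequentially. 0 < total m / gtotal m z"
    by (rule order_tendstoD(1)[OF gtotal_ratio]) simp
  then show ?thesis by eventually_elim auto
qed

lemma eventually_normal_form_bounded: "\<forall>\<^sub>F m in sequentially. \<bar>normal_form k (b m) z\<bar> \<le> (\<Sum>i<k. (z i)\<^sup>2) + (\<Sum>i<k. \<bar>z i\<bar>)\<^sup>2"
  using eventually_b_pos by eventually_elim (rule normal_form_bounded, auto)

text \<open>By the exact identity the difference is a factor tending to 0 times a bounded
  form.\<close>

lemma chi_form_minus_normal_form:
  "(\<lambda>m. chi_form k (b m) (normalized k (unstandardize (b m) z)) - normal_form k (b m) z) \<longlonglongrightarrow> 0"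
proof -
  have "(\<lambda>m. (total m / gtotal m z)\<^sup>2 - 1) \<longlonglongrightarrow> 1\<^sup>2 - 1"
    by (intro tendsto_intros gtotal_ratio)
  then have "(\<lambda>m. ((total m / gtotal m z)\<^sup>2 - 1) * normal_form k (b m) z) \<longlonglongrightarrow> 0"
    by (intro tendsto_0_mult_bounded[OF _ eventually_normal_form_bounded]) simp
  moreover have "\<forall>\<^sub>F m in sequentially. ((total m / gtotal m z)\<^sup>2 - 1) * normal_form k (b m) z
     = chi_form k (b m) (normalized k (unstandardize (b m) z)) - normal_form k (b m) z"
    using eventually_b_pos gtotal_nonzero[of z]
  proof eventually_elim
    case (elim m)
    then show ?case
      using k chi_form_normalized[of k "b m" z] by (simp add: gtotal_def total_def left_diff_distrib)
  qed
  ultimately show ?thesis by (rule Lim_transform_eventually)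
qed

lemma chi_form_bounded:
  obtains C where "\<forall>\<^sub>F m in sequentially. \<bar>chi_form k (b m) (normalized k (unstandardize (b m) z))\<bar> \<le> C"
proof -
  have "\<forall>\<^sub>F m in sequentially. \<bar>chi_form k (b m) (normalized k (unstandardize (b m) z)) - normal_form k (b m) z\<bar> < 1"
    using tendstoD[OF chi_form_minus_normal_form, of 1] by (simp add: dist_real_def)
  with eventually_normal_form_bounded[of z] have "\<forall>\<^sub>F m in sequentially.
     \<bar>chi_form k (b m) (normalized k (unstandardize (b m) z))\<bar> \<le> (\<Sum>i<k. (z i)\<^sup>2) + (\<Sum>i<k. \<bar>z i\<bar>)\<^sup>2 + 1"
    by eventually_elim linarith
  then show ?thesis by (rule that)
qed

text \<open>Write \<open>P = p * (1 + t)\<close> cell by cell. In the expansion of the logarithm the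
  linear terms sum to 0, the quadratic ones add up to the chi-square statistic, and the remainder is
  \<open>taylor_error (t m i)\<close>, which tends to 0, times summands of that bounded
  statistic.\<close>

lemma KL_form_minus_chi_form:
  "(\<lambda>m. KL_form k (b m) (normalized k (unstandardize (b m) z))
      - chi_form k (b m) (normalized k (unstandardize (b m) z))) \<longlonglongrightarrow> 0"
proof -
  define P where "P m = normalized k (unstandardize (b m) z)" for m
  define p where "p m i = b m i / total m" for m i
  define t where "t m i = P m i / p m i - 1" for m i
  obtain C where C: "\<forall>\<^sub>F m in sequentially. \<bar>chi_form k (b m) (P m)\<bar> \<le> C"
    unfolding P_def by (rule chi_form_bounded)
  have t0: "(\<lambda>m. t m i) \<longlonglongrightarrow> 0" if i: "i < k" for i
  proof -
    have "(\<lambda>m. inverse (sqrt (b m i))) \<longlonglongrightarrow> 0"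
      by (intro tendsto_inverse_0_at_top filterlim_compose[OF sqrt_at_top b] i)
    then have "(\<lambda>m. (total m / gtotal m z) * (1 + z i * inverse (sqrt (b m i))) - 1) \<longlonglongrightarrow> 1 * (1 + z i * 0) - 1"
      by (intro tendsto_intros gtotal_ratio)
    moreover have "\<forall>\<^sub>F m in sequentially. (total m / gtotal m z) * (1 + z i * inverse (sqrt (b m i))) - 1 = t m i"
      using eventually_b_pos gtotal_nonzero[of z]
    proof eventually_elim
      case (elim m)
      define r where "r = sqrt (b m i)"
      have r: "0 < r" "b m i = r\<^sup>2" using elim i by (simp_all add: r_def less_imp_le)
      have "t m i = (r\<^sup>2 + r * z i) / gtotal m z / (r\<^sup>2 / total m) - 1"
        unfolding t_def P_def p_def normalized_def gtotal_def[symmetric] unstandardize_def r_def[symmetric]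
        unfolding r(2) ..
      also have "\<dots> = (total m / gtotal m z) * ((r\<^sup>2 + r * z i) / r\<^sup>2) - 1"
        by simp
      also have "(r\<^sup>2 + r * z i) / r\<^sup>2 = 1 + z i * inverse r"
        using r(1) by (simp add: field_simps power2_eq_square)
      finally show ?case by (simp add: r_def)
    qed
    ultimately have "(\<lambda>m. t m i) \<longlonglongrightarrow> 1 * (1 + z i * 0) - 1"
      by (rule Lim_transform_eventually)
    then show ?thesis by simp
  qed
  have err: "(\<lambda>m. taylor_error (t m i)) \<longlonglongrightarrow> 0" if "i < k" for i
    using isCont_tendsto_compose[OF isCont_taylor_error t0[OF that]] by (simp add: taylor_error_def)
  have "(\<lambda>m. \<Sum>i<k. taylor_error (t m i) * (b m i * (t m i)\<^sup>2)) \<longlonglongrightarrow> (\<Sum>i<k. 0)"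
  proof (intro tendsto_sum tendsto_0_mult_bounded)
    fix i assume "i \<in> {..<k}"
    then have i: "i < k" by simp
    show "(\<lambda>m. taylor_error (t m i)) \<longlonglongrightarrow> 0" using err i .
    \<comment> \<open>This product is one summand of the chi-square statistic, whose summands are
      all nonnegative, so the bound \<open>C\<close> on the sum serves for it.\<close>
    show "\<forall>\<^sub>F m in sequentially. \<bar>b m i * (t m i)\<^sup>2\<bar> \<le> C"
      using C eventually_b_pos
    proof eventually_elim
      case (elim m)
      have a: "0 < total m" using total_pos elim by blast
      have "b m i * (t m i)\<^sup>2 = total m * ((P m i - p m i)\<^sup>2 / p m i)"
        if "i < k" for i
      proof -
        have "0 < b m i" using elim that by auto
        then have "t m i = (P m i - p m i) * total m / b m i"
          using a by (simp add: t_def p_def field_simps)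
        then show ?thesis
          using a \<open>0 < b m i\<close> by (simp add: p_def power_mult_distrib power_divide power2_eq_square)
      qed
      note * = this
      have "\<bar>b m i * (t m i)\<^sup>2\<bar> = b m i * (t m i)\<^sup>2"
        using elim i by (simp add: less_imp_le)
      also have "\<dots> \<le> (\<Sum>i<k. b m i * (t m i)\<^sup>2)"
        using elim i by (intro member_le_sum) (auto simp: less_imp_le)
      also have "\<dots> = chi_form k (b m) (P m)"
        unfolding chi_form_def Let_def total_def[symmetric] p_def[symmetric] sum_distrib_left
        by (intro sum.cong refl *) auto
      finally show ?case using elim by simp
    qed
  qed
  moreover have "\<forall>\<^sub>F m in sequentially. (\<Sum>i<k. taylor_error (t m i) * (b m i * (t m i)\<^sup>2))
     = KL_form k (b m) (P m) - chi_form k (b m) (P m)"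
    using eventually_b_pos gtotal_nonzero[of z]
  proof eventually_elim
    case (elim m)
    have a: "0 < total m" using total_pos elim by blast
    have P: "P m i = p m i * (1 + t m i)" "p m i \<noteq> 0" if "i < k" for i
    proof -
      have "b m i \<noteq> 0" using bspec[OF elim(1), of i] that by simp
      then show "P m i = p m i * (1 + t m i)" "p m i \<noteq> 0"
        using a by (simp_all add: t_def p_def)
    qed
    have "(\<Sum>i<k. P m i) = 1"
      using elim by (simp add: P_def normalized_def sum_divide_distrib[symmetric] gtotal_def)
    moreover have "(\<Sum>i<k. p m i) = 1"
      using a by (simp add: p_def sum_divide_distrib[symmetric] total_def)
    \<comment> \<open>Both vectors have sum 1, so the weighted deviations cancel.\<close>
    ultimately have zero: "(\<Sum>i<k. p m i * t m i) = 0"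
      using P(1) by (simp add: distrib_left sum.distrib)
    \<comment> \<open>Purely algebraic, hence valid for any value that \<open>ln\<close> takes on
      nonpositive arguments.\<close>
    have taylor: "taylor_error x * x\<^sup>2 = 2 * (1 + x) * ln (1 + x) - 2 * x - x\<^sup>2" for x
      by (cases "x = 0") (simp_all add: taylor_error_def)
    have "(\<Sum>i<k. taylor_error (t m i) * (b m i * (t m i)\<^sup>2))
       = (\<Sum>i<k. b m i * (taylor_error (t m i) * (t m i)\<^sup>2))"
      by (simp only: mult_ac)
    also have "\<dots> = (\<Sum>i<k. b m i * (2 * (1 + t m i) * ln (1 + t m i) - 2 * t m i - (t m i)\<^sup>2))"
      by (simp only: taylor)
    also have "\<dots> = (\<Sum>i<k. 2 * total m * (P m i * ln (P m i / p m i)) - 2 * total m * (p m i * t m i)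
         - total m * ((P m i - p m i)\<^sup>2 / p m i))"
    proof (intro sum.cong refl)
      fix i assume "i \<in> {..<k}"
      then have i: "i < k" by simp
      have bp: "b m i = total m * p m i" using a by (simp add: p_def)
      have 1: "P m i / p m i = 1 + t m i" using P[OF i] by simp
      have 2: "(P m i - p m i)\<^sup>2 / p m i = p m i * (t m i)\<^sup>2"
        using P[OF i] by (simp add: power2_eq_square algebra_simps)
      show "b m i * (2 * (1 + t m i) * ln (1 + t m i) - 2 * t m i - (t m i)\<^sup>2)
        = 2 * total m * (P m i * ln (P m i / p m i)) - 2 * total m * (p m i * t m i)
         - total m * ((P m i - p m i)\<^sup>2 / p m i)"
        unfolding 1 2 unfolding bp P(1)[OF i] by (simp add: algebra_simps)
    qed
    also have "\<dots> = KL_form k (b m) (P m) - chi_form k (b m) (P m)"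
      unfolding KL_form_def chi_form_def Let_def total_def[symmetric] p_def[symmetric]
      by (simp only: sum_subtractf sum_distrib_left[symmetric] zero mult_zero_right diff_zero)
    finally show ?case .
  qed
  ultimately have "(\<lambda>m. KL_form k (b m) (P m) - chi_form k (b m) (P m)) \<longlonglongrightarrow> (\<Sum>i<k. 0)"
    by (rule Lim_transform_eventually)
  then show ?thesis by (simp add: P_def)
qed

end

section \<open>From pointwise convergence to convergence of probabilities\<close>

lemma tendsto_measure_exceed:
  assumes "prob_space M"
    and [measurable]: "\<And>m. Y m \<in> borel_measurable M"
    and lim: "\<And>z. z \<in> space M \<Longrightarrow> (\<lambda>m. Y m z) \<longlonglongrightarrow> (0 :: real)" and e: "0 < e"
  shows "(\<lambda>m. measure M {z \<in> space M. e < \<bar>Y m z\<bar>}) \<longlonglongrightarrow> 0"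
proof -
  interpret prob_space M by fact
  have "(\<lambda>m. \<integral>z. indicator {z \<in> space M. e < \<bar>Y m z\<bar>} z \<partial>M) \<longlonglongrightarrow> (\<integral>z. (0::real) \<partial>M)"
  proof (rule integral_dominated_convergence[where w="\<lambda>_. 1"])
    show "AE z in M. (\<lambda>m. indicator {z \<in> space M. e < \<bar>Y m z\<bar>} z) \<longlonglongrightarrow> (0::real)"
    proof (rule AE_I2)
      fix z assume "z \<in> space M"
      from tendstoD[OF lim[OF this] e] have "\<forall>\<^sub>F m in sequentially. indicator {z \<in> space M. e < \<bar>Y m z\<bar>} z = (0::real)"
        by eventually_elim (auto simp: dist_real_def)
      then show "(\<lambda>m. indicator {z \<in> space M. e < \<bar>Y m z\<bar>} z) \<longlonglongrightarrow> (0::real)"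
        by (rule tendsto_eventually)
    qed
  qed (auto simp: indicator_def)
  moreover have "(\<integral>z. indicator {z \<in> space M. e < \<bar>Y m z\<bar>} z \<partial>M) = measure M {z \<in> space M. e < \<bar>Y m z\<bar>}" for m
  proof -
    have "{z \<in> space M. e < \<bar>Y m z\<bar>} \<inter> space M = {z \<in> space M. e < \<bar>Y m z\<bar>}" by auto
    then show ?thesis by simp
  qed
  ultimately show ?thesis by simp
qed

text \<open>The variables \<open>Y m\<close> may fail to converge; only their common law matters. Up
  to the event that \<open>Z m\<close> and \<open>Y m\<close> differ by more than \<open>h\<close>,
  the event for \<open>Z m\<close> at \<open>x\<close> lies between those for \<open>Y m\<close> at
  \<open>x - h\<close> and \<open>x + h\<close>, whose probabilities are values of one fixed
  distribution function, continuous at \<open>x\<close>.\<close>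

lemma slutsky_same_law:
  fixes Y Z :: "nat \<Rightarrow> 'a \<Rightarrow> real"
  assumes "prob_space M"
    and Y[measurable]: "\<And>m. Y m \<in> borel_measurable M" and Z[measurable]: "\<And>m. Z m \<in> borel_measurable M"
    and law: "\<forall>\<^sub>F m in sequentially. distr M borel (Y m) = \<nu>"
    and cont: "isCont (cdf \<nu>) x"
    and lim: "\<And>z. z \<in> space M \<Longrightarrow> (\<lambda>m. Z m z - Y m z) \<longlonglongrightarrow> 0"
  shows "(\<lambda>m. measure M {z \<in> space M. Z m z \<le> x}) \<longlonglongrightarrow> cdf \<nu> x"
proof (rule tendstoI)
  interpret prob_space M by fact
  fix e :: real assume e: "0 < e"
  from cont e obtain d where d: "0 < d" "\<And>y. \<bar>y - x\<bar> < d \<Longrightarrow> \<bar>cdf \<nu> y - cdf \<nu> x\<bar> < e / 2"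
    using LIM_D[of "cdf \<nu>" "cdf \<nu> x" x "e / 2"] unfolding isCont_def
    by (metis abs_zero diff_self half_gt_zero real_norm_def)
  define h where "h = d / 2"
  have h: "0 < h" "h < d" using d(1) by (auto simp: h_def)
  have exc: "\<forall>\<^sub>F m in sequentially. measure M {z \<in> space M. h < \<bar>Z m z - Y m z\<bar>} < e / 2"
    using e h by (intro order_tendstoD(2)[OF tendsto_measure_exceed[OF assms(1)]] lim) auto
  show "\<forall>\<^sub>F m in sequentially. dist (measure M {z \<in> space M. Z m z \<le> x}) (cdf \<nu> x) < e"
    using exc law
  proof eventually_elim
    case (elim m)
    have cdf: "cdf \<nu> y = measure M {z \<in> space M. Y m z \<le> y}" for y
    proof -
      have "cdf \<nu> y = measure M (Y m -` {..y} \<inter> space M)"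
        unfolding cdf_def elim(2)[symmetric] by (rule measure_distr) auto
      also have "Y m -` {..y} \<inter> space M = {z \<in> space M. Y m z \<le> y}" by auto
      finally show ?thesis .
    qed
    have up: "\<bar>cdf \<nu> (x + h) - cdf \<nu> x\<bar> < e / 2"
      by (rule d(2)) (use h in simp)
    have down: "\<bar>cdf \<nu> (x - h) - cdf \<nu> x\<bar> < e / 2"
      by (rule d(2)) (use h in simp)
    have "measure M {z \<in> space M. Z m z \<le> x}
        \<le> measure M ({z \<in> space M. Y m z \<le> x + h} \<union> {z \<in> space M. h < \<bar>Z m z - Y m z\<bar>})"
      by (intro finite_measure_mono) auto
    also have "\<dots> \<le> cdf \<nu> (x + h) + measure M {z \<in> space M. h < \<bar>Z m z - Y m z\<bar>}"
      unfolding cdf by (intro measure_Un_le) auto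
    finally have 1: "measure M {z \<in> space M. Z m z \<le> x} < cdf \<nu> x + e"
      using elim(1) up by linarith
    have "cdf \<nu> (x - h)
        \<le> measure M ({z \<in> space M. Z m z \<le> x} \<union> {z \<in> space M. h < \<bar>Z m z - Y m z\<bar>})"
      unfolding cdf by (intro finite_measure_mono) auto
    also have "\<dots> \<le> measure M {z \<in> space M. Z m z \<le> x} + measure M {z \<in> space M. h < \<bar>Z m z - Y m z\<bar>}"
      by (intro measure_Un_le) auto
    finally have 2: "cdf \<nu> x - e < measure M {z \<in> space M. Z m z \<le> x}"
      using elim(1) down by linarith
    show ?case using 1 2 by (simp add: dist_real_def abs_less_iff)
  qed
qed

section \<open>Dirichlet laws with diverging weights\<close>

lemma distr_PiM_components:
  assumes I: "finite I" and M: "\<And>i. i \<in> I \<Longrightarrow> prob_space (M i)"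
    and f: "\<And>i. i \<in> I \<Longrightarrow> f i \<in> measurable (M i) (N i)"
  shows "distr (PiM I M) (PiM I N) (\<lambda>x. \<lambda>i\<in>I. f i (x i)) = PiM I (\<lambda>i. distr (M i) (N i) (f i))"
proof -
  \<comment> \<open>Indices outside \<open>I\<close> carry arbitrary measures; point masses replace
    them to give a family of probability spaces without changing the products over
    \<open>I\<close>.\<close>
  define D where "D i = (if i \<in> I then distr (M i) (N i) (f i) else return (count_space UNIV) undefined)" for i
  define M' where "M' i = (if i \<in> I then M i else return (count_space UNIV) undefined)" for i
  interpret D: product_prob_space D
    by (intro product_prob_spaceI) (auto simp: D_def intro!: prob_space.prob_space_distr M f prob_space_return)
  interpret M': product_prob_space M'
    by (intro product_prob_spaceI) (auto simp: M'_def intro!: M prob_space_return)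
  have PM: "PiM I M = PiM I M'" by (intro PiM_cong) (auto simp: M'_def)
  have meas: "(\<lambda>x. \<lambda>i\<in>I. f i (x i)) \<in> measurable (PiM I M) (PiM I N)"
    using f by (intro measurable_restrict measurable_compose[OF measurable_component_singleton])
  have "distr (PiM I M) (PiM I N) (\<lambda>x. \<lambda>i\<in>I. f i (x i)) = PiM I D"
  proof (rule D.PiM_eqI[OF I])
    show "sets (distr (PiM I M) (PiM I N) (\<lambda>x. \<lambda>i\<in>I. f i (x i))) = sets (PiM I D)"
      by (auto simp: D_def intro!: sets_PiM_cong)
    fix A assume "\<And>i. i \<in> I \<Longrightarrow> A i \<in> sets (D i)"
    then have A: "A i \<in> sets (N i)" if "i \<in> I" for i
      using that by (auto simp: D_def)
    have "emeasure (distr (PiM I M) (PiM I N) (\<lambda>x. \<lambda>i\<in>I. f i (x i))) (Pi\<^sub>E I A)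
        = emeasure (PiM I M) ((\<lambda>x. \<lambda>i\<in>I. f i (x i)) -` Pi\<^sub>E I A \<inter> space (PiM I M))"
      using A I by (intro emeasure_distr meas sets_PiM_I_finite)
    also have "(\<lambda>x. \<lambda>i\<in>I. f i (x i)) -` Pi\<^sub>E I A \<inter> space (PiM I M) = (\<Pi>\<^sub>E i\<in>I. f i -` A i \<inter> space (M i))"
      by (auto simp: space_PiM PiE_def Pi_def)
    also have "emeasure (PiM I M) (\<Pi>\<^sub>E i\<in>I. f i -` A i \<inter> space (M i)) = (\<Prod>i\<in>I. emeasure (M' i) (f i -` A i \<inter> space (M i)))"
      unfolding PM using A f I by (intro M'.emeasure_PiM) (auto simp: M'_def intro: measurable_sets)
    also have "\<dots> = (\<Prod>i\<in>I. emeasure (D i) (A i))"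
      using A f by (intro prod.cong) (auto simp: D_def M'_def emeasure_distr)
    finally show "emeasure (distr (PiM I M) (PiM I N) (\<lambda>x. \<lambda>i\<in>I. f i (x i))) (Pi\<^sub>E I A) = (\<Prod>i\<in>I. emeasure (D i) (A i))" .
  qed
  also have "\<dots> = PiM I (\<lambda>i. distr (M i) (N i) (f i))"
    by (intro PiM_cong) (auto simp: D_def)
  finally show ?thesis .
qed

lemma dirichlet_eq_distr_std_gamma:
  assumes b: "\<And>i. i < k \<Longrightarrow> 0 < b i"
  shows "dirichlet k b = distr (std_gamma_PiM k b) (PiM {..<k} (\<lambda>_. borel))
     (\<lambda>z. \<lambda>i\<in>{..<k}. normalized k (unstandardize b z) i)"
proof -
  have "PiM {..<k} (\<lambda>i. gamma_meas (b i))
     = PiM {..<k} (\<lambda>i. distr (density lborel (\<lambda>z. ennreal (std_gamma_density (b i) z))) borel (\<lambda>z. b i + sqrt (b i) * z))"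
    using b by (intro PiM_cong) (auto simp: gamma_meas_eq_distr)
  also have "\<dots> = distr (std_gamma_PiM k b) (PiM {..<k} (\<lambda>_. borel)) (\<lambda>z. \<lambda>i\<in>{..<k}. b i + sqrt (b i) * z i)"
    using b by (intro distr_PiM_components[symmetric]) (auto intro: prob_space_std_gamma)
  finally have G: "PiM {..<k} (\<lambda>i. gamma_meas (b i))
     = distr (std_gamma_PiM k b) (PiM {..<k} (\<lambda>_. borel)) (\<lambda>z. \<lambda>i\<in>{..<k}. b i + sqrt (b i) * z i)" .
  show ?thesis
    unfolding dirichlet_def G
    by (subst distr_distr)
       (auto simp: comp_def normalized_def unstandardize_def intro!: distr_cong ext)
qed

lemma chi_form_restrict: "chi_form k c (\<lambda>i\<in>{..<k}. P i) = chi_form k c P"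
  by (simp add: chi_form_def)

lemma KL_form_restrict: "KL_form k c (\<lambda>i\<in>{..<k}. P i) = KL_form k c P"
  by (simp add: KL_form_def)

lemma chi_form_measurable [measurable]: "chi_form k c \<in> borel_measurable (PiM {..<k} (\<lambda>_. borel))"
  unfolding chi_form_def Let_def by measurable

lemma KL_form_measurable [measurable]: "KL_form k c \<in> borel_measurable (PiM {..<k} (\<lambda>_. borel))"
  unfolding KL_form_def Let_def by measurable

context diverging_weights
begin

lemma distr_normal_form:
  assumes "2 \<le> k" "\<forall>i\<in>{..<k}. 0 < b m i"
  shows "distr (std_normal_PiM k) borel (normal_form k (b m)) = chi_sq (real k - 1)"
proof -
  have pos: "0 < total m" using total_pos assms by blast
  have "(\<Sum>i<k. (sqrt (b m i / total m))\<^sup>2) = (\<Sum>i<k. b m i / total m)"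
    using assms pos by (intro sum.cong) (auto intro!: real_sqrt_pow2 divide_nonneg_pos less_imp_le)
  also have "\<dots> = 1"
    using pos by (simp add: sum_divide_distrib[symmetric] total_def)
  finally show ?thesis
    unfolding normal_form_def[abs_def] total_def[symmetric] using assms pos
    by (intro distr_std_normal_quadratic_form) auto
qed

text \<open>The probability on \<open>\<Omega> m\<close> depends only on the Dirichlet law, an image
  of the standardised gamma product. Pulling the event back to \<open>z\<close> and replacing that
  product by the Gaussian one costs an error that vanishes in total variation, even though both
  event and space change with \<open>m\<close>.\<close>

lemma measure_dirichlet_limit:
  fixes \<Omega> :: "nat \<Rightarrow> 'w measure" and V :: "nat \<Rightarrow> 'w \<Rightarrow> nat \<Rightarrow> real"
  assumes V: "\<And>m. V m \<in> measurable (\<Omega> m) (PiM {..<k} (\<lambda>_. borel))"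
    and law: "\<And>m. distr (\<Omega> m) (PiM {..<k} (\<lambda>_. borel)) (V m) = dirichlet k (b m)"
    and R: "\<And>m. Measurable.pred (PiM {..<k} (\<lambda>_. borel)) (R m)"
    and lim: "(\<lambda>m. measure (std_normal_PiM k) {z \<in> space (std_normal_PiM k).
        R m (\<lambda>i\<in>{..<k}. normalized k (unstandardize (b m) z) i)}) \<longlonglongrightarrow> L"
  shows "(\<lambda>m. measure (\<Omega> m) {w \<in> space (\<Omega> m). R m (V m w)}) \<longlonglongrightarrow> L"
proof -
  let ?B = "PiM {..<k} (\<lambda>_. borel) :: (nat \<Rightarrow> real) measure"
  define \<pi> where "\<pi> m z = (\<lambda>i\<in>{..<k}. normalized k (unstandardize (b m) z) i)" for m z
  have \<pi>: "\<pi> m \<in> measurable ?B ?B" for m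
    unfolding \<pi>_def normalized_def unstandardize_def by measurable
  define E where "E m = {z \<in> space ?B. R m (\<pi> m z)}" for m
  have E: "E m \<in> sets ?B" for m
    unfolding E_def using measurable_compose[OF \<pi> R] by simp
  have sp: "space (std_normal_PiM k) = space ?B" "space (std_gamma_PiM k c) = space ?B" for c
    by (simp_all add: space_PiM)
  have "(\<lambda>m. (measure (std_gamma_PiM k (b m)) (E m) - measure (std_normal_PiM k) (E m))
      + measure (std_normal_PiM k) (E m)) \<longlonglongrightarrow> 0 + L"
    using lim by (intro tendsto_add std_gamma_PiM_tv b E) (simp_all add: E_def \<pi>_def sp)
  moreover have "\<forall>\<^sub>F m in sequentially. (measure (std_gamma_PiM k (b m)) (E m) - measure (std_normal_PiM k) (E m))
      + measure (std_normal_PiM k) (E m) = measure (\<Omega> m) {w \<in> space (\<Omega> m). R m (V m w)}"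
    \<comment> \<open>The standardised representation needs positive weights; a weight may still be
      0 for small \<open>m\<close>.\<close>
    using eventually_b_pos
  proof eventually_elim
    case (elim m)
    have RS: "{v \<in> space ?B. R m v} \<in> sets ?B" using R by simp
    have "measure (\<Omega> m) {w \<in> space (\<Omega> m). R m (V m w)} = measure (\<Omega> m) (V m -` {v \<in> space ?B. R m v} \<inter> space (\<Omega> m))"
      using measurable_space[OF V] by (intro arg_cong[where f="measure _"]) auto
    also have "\<dots> = measure (dirichlet k (b m)) {v \<in> space ?B. R m v}"
      unfolding law[symmetric] by (rule measure_distr[symmetric, OF V RS])
    also have "dirichlet k (b m) = distr (std_gamma_PiM k (b m)) ?B (\<pi> m)"
      unfolding \<pi>_def using elim by (intro dirichlet_eq_distr_std_gamma) auto
    also have "measure \<dots> {v \<in> space ?B. R m v}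
        = measure (std_gamma_PiM k (b m)) (\<pi> m -` {v \<in> space ?B. R m v} \<inter> space (std_gamma_PiM k (b m)))"
      using \<pi>[of m] RS by (intro measure_distr) (simp_all cong: measurable_cong_sets sets_PiM_cong)
    also have "\<pi> m -` {v \<in> space ?B. R m v} \<inter> space (std_gamma_PiM k (b m)) = E m"
      using measurable_space[OF \<pi>] by (auto simp: E_def sp)
    finally show ?case by simp
  qed
  ultimately have "(\<lambda>m. measure (\<Omega> m) {w \<in> space (\<Omega> m). R m (V m w)}) \<longlonglongrightarrow> 0 + L"
    by (rule Lim_transform_eventually)
  then show ?thesis by simp
qed

text \<open>The distribution function at a continuity point is the probability of an event about
  \<open>V m\<close>, so it can be computed for a Gaussian \<open>z\<close>, where the normal form
  has the limit law exactly.\<close>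

lemma weak_conv_dirichlet:
  fixes \<Omega> :: "nat \<Rightarrow> 'w measure" and V :: "nat \<Rightarrow> 'w \<Rightarrow> nat \<Rightarrow> real"
  assumes k2: "2 \<le> k"
    and V: "\<And>m. V m \<in> measurable (\<Omega> m) (PiM {..<k} (\<lambda>_. borel))"
    and law: "\<And>m. distr (\<Omega> m) (PiM {..<k} (\<lambda>_. borel)) (V m) = dirichlet k (b m)"
    and F: "\<And>m. F m \<in> borel_measurable (PiM {..<k} (\<lambda>_. borel))"
    and lim: "\<And>z. (\<lambda>m. F m (\<lambda>i\<in>{..<k}. normalized k (unstandardize (b m) z) i) - normal_form k (b m) z) \<longlonglongrightarrow> 0"
  shows "weak_conv_m (\<lambda>m. distr (\<Omega> m) borel (\<lambda>w. F m (V m w))) (chi_sq (real k - 1))"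
  unfolding weak_conv_m_def weak_conv_def
proof (intro allI impI)
  let ?B = "PiM {..<k} (\<lambda>_. borel) :: (nat \<Rightarrow> real) measure"
  fix x assume cont: "isCont (cdf (chi_sq (real k - 1))) x"
  have \<pi>: "(\<lambda>z. \<lambda>i\<in>{..<k}. normalized k (unstandardize (b m) z) i) \<in> measurable (std_normal_PiM k) ?B" for m
    unfolding normalized_def unstandardize_def by measurable
  have "prob_space (std_normal_PiM k)"
    by (intro prob_space_PiM prob_space_std_normal)
  then have "(\<lambda>m. measure (std_normal_PiM k) {z \<in> space (std_normal_PiM k).
        F m (\<lambda>i\<in>{..<k}. normalized k (unstandardize (b m) z) i) \<le> x}) \<longlonglongrightarrow> cdf (chi_sq (real k - 1)) x"
  proof (rule slutsky_same_law)
    show "normal_form k (b m) \<in> borel_measurable (std_normal_PiM k)" for m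
      unfolding normal_form_def by measurable
    show "\<forall>\<^sub>F m in sequentially. distr (std_normal_PiM k) borel (normal_form k (b m)) = chi_sq (real k - 1)"
      using eventually_b_pos by eventually_elim (rule distr_normal_form[OF k2])
  qed (use measurable_compose[OF \<pi> F] cont lim in auto)
  then have "(\<lambda>m. measure (\<Omega> m) {w \<in> space (\<Omega> m). F m (V m w) \<le> x}) \<longlonglongrightarrow> cdf (chi_sq (real k - 1)) x"
    using F by (intro measure_dirichlet_limit[OF V law, where R="\<lambda>m v. F m v \<le> x"]) measurable
  moreover have "cdf (distr (\<Omega> m) borel (\<lambda>w. F m (V m w))) x = measure (\<Omega> m) {w \<in> space (\<Omega> m). F m (V m w) \<le> x}" for m
  proof -
    have "cdf (distr (\<Omega> m) borel (\<lambda>w. F m (V m w))) x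
        = measure (\<Omega> m) ((\<lambda>w. F m (V m w)) -` {..x} \<inter> space (\<Omega> m))"
      unfolding cdf_def using measurable_compose[OF V F] by (intro measure_distr) auto
    then show ?thesis by (simp add: vimage_def Int_def conj_commute)
  qed
  ultimately show "(\<lambda>m. cdf (distr (\<Omega> m) borel (\<lambda>w. F m (V m w))) x) \<longlonglongrightarrow> cdf (chi_sq (real k - 1)) x"
    by simp
qed

lemma conv_prob_zero_dirichlet:
  fixes \<Omega> :: "nat \<Rightarrow> 'w measure" and V :: "nat \<Rightarrow> 'w \<Rightarrow> nat \<Rightarrow> real"
  assumes V: "\<And>m. V m \<in> measurable (\<Omega> m) (PiM {..<k} (\<lambda>_. borel))"
    and law: "\<And>m. distr (\<Omega> m) (PiM {..<k} (\<lambda>_. borel)) (V m) = dirichlet k (b m)"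
    and F: "\<And>m. F m \<in> borel_measurable (PiM {..<k} (\<lambda>_. borel))"
    and lim: "\<And>z. (\<lambda>m. F m (\<lambda>i\<in>{..<k}. normalized k (unstandardize (b m) z) i)) \<longlonglongrightarrow> (0 :: real)"
  shows "conv_prob_zero \<Omega> (\<lambda>m w. F m (V m w))"
  unfolding conv_prob_zero_def
proof (intro allI impI)
  let ?B = "PiM {..<k} (\<lambda>_. borel) :: (nat \<Rightarrow> real) measure"
  fix e :: real assume e: "0 < e"
  have \<pi>: "(\<lambda>z. \<lambda>i\<in>{..<k}. normalized k (unstandardize (b m) z) i) \<in> measurable (std_normal_PiM k) ?B" for m
    unfolding normalized_def unstandardize_def by measurable
  have "prob_space (std_normal_PiM k)"
    by (intro prob_space_PiM prob_space_std_normal)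
  then have "(\<lambda>m. measure (std_normal_PiM k) {z \<in> space (std_normal_PiM k).
      e < \<bar>F m (\<lambda>i\<in>{..<k}. normalized k (unstandardize (b m) z) i)\<bar>}) \<longlonglongrightarrow> 0"
    using measurable_compose[OF \<pi> F] lim e by (intro tendsto_measure_exceed) auto
  then show "(\<lambda>m. measure (\<Omega> m) {w \<in> space (\<Omega> m). e < \<bar>F m (V m w)\<bar>}) \<longlonglongrightarrow> 0"
    using F by (intro measure_dirichlet_limit[OF V law, where R="\<lambda>m v. e < \<bar>F m v\<bar>"]) measurable
qed

lemma dirichlet_chi_square_limits:
  fixes \<Omega> :: "nat \<Rightarrow> 'w measure" and V :: "nat \<Rightarrow> 'w \<Rightarrow> nat \<Rightarrow> real"
  assumes k2: "2 \<le> k"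
    and V: "\<And>m. V m \<in> measurable (\<Omega> m) (PiM {..<k} (\<lambda>_. borel))"
    and law: "\<And>m. distr (\<Omega> m) (PiM {..<k} (\<lambda>_. borel)) (V m) = dirichlet k (b m)"
  shows "weak_conv_m (\<lambda>m. distr (\<Omega> m) borel (\<lambda>w. chi_form k (b m) (V m w))) (chi_sq (real k - 1))"
    and "conv_prob_zero \<Omega> (\<lambda>m w. KL_form k (b m) (V m w) - chi_form k (b m) (V m w))"
    and "weak_conv_m (\<lambda>m. distr (\<Omega> m) borel (\<lambda>w. KL_form k (b m) (V m w))) (chi_sq (real k - 1))"
proof -
  show "weak_conv_m (\<lambda>m. distr (\<Omega> m) borel (\<lambda>w. chi_form k (b m) (V m w))) (chi_sq (real k - 1))"
    by (intro weak_conv_dirichlet[OF k2 V law, where F="\<lambda>m. chi_form k (b m)"])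
       (simp_all add: chi_form_restrict chi_form_minus_normal_form)
  show "conv_prob_zero \<Omega> (\<lambda>m w. KL_form k (b m) (V m w) - chi_form k (b m) (V m w))"
    using KL_form_minus_chi_form
    by (intro conv_prob_zero_dirichlet[OF V law, where F="\<lambda>m v. KL_form k (b m) v - chi_form k (b m) v"])
       (simp_all add: chi_form_restrict KL_form_restrict)
  have "(\<lambda>m. KL_form k (b m) (normalized k (unstandardize (b m) z)) - normal_form k (b m) z) \<longlonglongrightarrow> 0" for z
    using tendsto_add[OF KL_form_minus_chi_form chi_form_minus_normal_form, of z z] by simp
  then show "weak_conv_m (\<lambda>m. distr (\<Omega> m) borel (\<lambda>w. KL_form k (b m) (V m w))) (chi_sq (real k - 1))"
    by (intro weak_conv_dirichlet[OF k2 V law, where F="\<lambda>m. KL_form k (b m)"]) (simp_all add: KL_form_restrict)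
qed

end

section \<open>The posterior Dirichlet process\<close>

text \<open>\<open>measure_of\<close> yields the null measure for a set function that is not a
  measure, so this is what makes the formula in \<open>post_base\<close> effective.\<close>

lemma post_base_countably_additive:
  assumes "prob_space H" and [measurable_cong]: "sets H = sets M" and alpha: "0 < alpha"
  shows "countably_additive (sets M)
     (\<lambda>B. ennreal ((alpha * measure H B + (\<Sum>i<m. indicator B (x i))) / (alpha + real m)))"
proof (rule countably_additiveI)
  interpret H: prob_space H by fact
  fix A :: "nat \<Rightarrow> 'a set"
  assume A: "range A \<subseteq> sets M" "disjoint_family A" "(\<Union>i. A i) \<in> sets M"
  let ?f = "\<lambda>B. (alpha * measure H B + (\<Sum>i<m. indicator B (x i))) / (alpha + real m)"
  have 1: "(\<lambda>n. measure H (A n)) sums measure H (\<Union>n. A n)"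
    using A assms(2) by (intro H.finite_measure_UNION) auto
  have 2: "(\<lambda>n. indicator (A n) y :: real) sums indicator (\<Union>n. A n) y" for y
    using A(2) by (intro indicator_sums) (auto simp: disjoint_family_on_def)
  have "(\<lambda>n. ?f (A n)) sums ?f (\<Union>n. A n)"
    by (intro sums_divide sums_add sums_mult sums_sum 1 2)
  then show "(\<Sum>n. ennreal (?f (A n))) = ennreal (?f (\<Union>n. A n))"
    using alpha
    by (subst suminf_ennreal2) (auto intro!: divide_nonneg_pos add_nonneg_nonneg sum_nonneg simp: sums_iff)
qed

lemma sets_post_base [simp]: "sets (post_base M alpha H x m) = sets M"
  by (simp add: post_base_def sets.sigma_sets_eq)

lemma emeasure_post_base:
  assumes "prob_space H" "sets H = sets M" "0 < alpha" "B \<in> sets M"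
  shows "emeasure (post_base M alpha H x m) B =
     ennreal ((alpha * measure H B + (\<Sum>i<m. indicator B (x i))) / (alpha + real m))"
proof (rule emeasure_measure_of[OF post_base_def])
  show "sets M \<subseteq> Pow (space M)" by (rule sets.space_closed)
  show "B \<in> sets (post_base M alpha H x m)"
    "countably_additive (sets (post_base M alpha H x m))
      (\<lambda>B. ennreal ((alpha * measure H B + (\<Sum>i<m. indicator B (x i))) / (alpha + real m)))"
    using assms post_base_countably_additive[OF assms(1-3)] by simp_all
qed (simp add: positive_def)

lemma measure_post_base:
  assumes "prob_space H" "sets H = sets M" "0 < alpha" "B \<in> sets M"
  shows "measure (post_base M alpha H x m) B =
     (alpha * measure H B + (\<Sum>i<m. indicator B (x i))) / (alpha + real m)"
  unfolding measure_def emeasure_post_base[OF assms] using assms(3)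
  by (subst enn2real_ennreal) (auto intro!: divide_nonneg_pos add_nonneg_nonneg sum_nonneg)

lemma prob_space_post_base:
  assumes "prob_space H" "sets H = sets M" "0 < alpha" "\<And>i. x i \<in> space M"
  shows "prob_space (post_base M alpha H x m)"
proof (rule prob_spaceI)
  interpret H: prob_space H by fact
  have "measure H (space M) = 1"
    using H.prob_space sets_eq_imp_space_eq[OF assms(2)] by simp
  moreover have "space (post_base M alpha H x m) = space M"
    by (simp add: post_base_def)
  ultimately show "emeasure (post_base M alpha H x m) (space (post_base M alpha H x m)) = 1"
    using assms by (simp add: emeasure_post_base)
qed

section \<open>Recurrence of the cells in the sample\<close>

lemma filterlim_count_at_top:
  fixes B :: "'a set"
  assumes "\<And>n. \<exists>j\<ge>n. x j \<in> B"
  shows "filterlim (\<lambda>m. \<Sum>j<m. indicator B (x j) :: real) at_top sequentially"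
proof -
  let ?c = "\<lambda>m. \<Sum>j<m. indicator B (x j) :: real"
  have mono: "?c m \<le> ?c n" if "m \<le> n" for m n
    using that by (intro sum_mono2) auto
  have unbounded: "\<exists>m. real K \<le> ?c m" for K
  proof (induction K)
    case (Suc K)
    then obtain m where m: "real K \<le> ?c m" by blast
    obtain j where "j \<ge> m" "x j \<in> B" using assms by blast
    \<comment> \<open>The count up to \<open>m\<close> excludes index \<open>m\<close>, so the visit
      at \<open>j \<ge> m\<close> is new; it is included from \<open>Suc j\<close> on.\<close>
    then have "real (Suc K) \<le> ?c (Suc j)" using m mono[of m j] by simp
    then show ?case by blast
  qed (auto intro: sum_nonneg)
  show ?thesis
    unfolding filterlim_at_top
  proof
    fix Z :: real
    obtain K where "Z \<le> real K" using real_arch_simple by blast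
    moreover obtain m where "real K \<le> ?c m" using unbounded by blast
    ultimately have "Z \<le> ?c n" if "n \<ge> m" for n using mono[OF that] by linarith
    then show "\<forall>\<^sub>F m in sequentially. Z \<le> ?c m"
      by (auto simp: eventually_sequentially)
  qed
qed

text \<open>By independence the draws \<open>n\<close> to \<open>n + l\<close> all miss
  \<open>B\<close> with probability \<open>(1 - p) ^ Suc l\<close>, which tends to 0 as
  \<open>l\<close> grows.\<close>

lemma (in prob_space) AE_iid_visits:
  fixes X :: "nat \<Rightarrow> 'a \<Rightarrow> 'b" and n :: nat
  assumes X: "\<And>i. X i \<in> measurable M N" and indep: "indep_vars (\<lambda>_. N) X UNIV"
    and law: "\<And>i. distr M N (X i) = F" and B [measurable]: "B \<in> sets N" and pos: "0 < measure F B"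
  shows "AE s in M. \<exists>j\<ge>n. X j s \<in> B"
proof -
  note [measurable] = X
  have "prob_space F" using prob_space_distr[OF X] law by metis
  then interpret F: prob_space F .
  define p where "p = measure F B"
  have SF: "space N = space F" "sets N = sets F" using law by (metis space_distr, metis sets_distr)
  have miss: "prob (X j -` (space N - B) \<inter> space M) = 1 - p" for j
  proof -
    have "prob (X j -` (space N - B) \<inter> space M) = measure (distr M N (X j)) (space N - B)"
      by (subst measure_distr) auto
    also have "\<dots> = 1 - p"
      unfolding law p_def SF(1) by (rule F.prob_compl) (use B SF in simp)
    finally show ?thesis .
  qed
  have bound: "prob {s \<in> space M. \<forall>j\<ge>n. X j s \<notin> B} \<le> (1 - p) ^ Suc l" for l
  proof -
    have "{s \<in> space M. \<forall>j\<ge>n. X j s \<notin> B} \<subseteq> (\<Inter>j\<in>{n..n+l}. X j -` (space N - B) \<inter> space M)"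
      using measurable_space[OF X] by auto
    then have "prob {s \<in> space M. \<forall>j\<ge>n. X j s \<notin> B} \<le> prob (\<Inter>j\<in>{n..n+l}. X j -` (space N - B) \<inter> space M)"
      by (intro finite_measure_mono sets.finite_INT) auto
    also have "\<dots> = (\<Prod>j\<in>{n..n+l}. prob (X j -` (space N - B) \<inter> space M))"
      by (intro indep_varsD[OF indep]) auto
    also have "\<dots> = (1 - p) ^ Suc l" by (simp add: miss)
    finally show ?thesis .
  qed
  have "(\<lambda>l. (1 - p) ^ Suc l) \<longlonglongrightarrow> 0"
    using pos F.prob_le_1[of B] by (intro LIMSEQ_Suc LIMSEQ_power_zero) (auto simp: p_def)
  then have "prob {s \<in> space M. \<forall>j\<ge>n. X j s \<notin> B} \<le> 0"
    using bound by (intro LIMSEQ_le_const[of _ 0]) auto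
  then have "prob {s \<in> space M. \<forall>j\<ge>n. X j s \<notin> B} = 0"
    using measure_nonneg by (intro antisym)
  moreover have "{s \<in> space M. \<forall>j\<ge>n. X j s \<notin> B} \<in> events" by measurable
  ultimately show ?thesis
    by (intro AE_I[of _ _ "{s \<in> space M. \<forall>j\<ge>n. X j s \<notin> B}"]) (auto simp: emeasure_eq_measure)
qed

text \<open>Conditioning is expressed by the family \<open>Q m x\<close>: for each realised sequence
  and each \<open>m\<close> a probability space carrying the posterior process. Once
  \<open>x\<close> is fixed outside a null set, the claims concern only the laws of the cell
  probabilities on these spaces.\<close>

theorem theorem4p3:
  fixes M :: "'a measure" and H F :: "'a measure" and alpha :: real
    and S :: "'s measure" and X :: "nat \<Rightarrow> 's \<Rightarrow> 'a"
    and k :: nat and A :: "nat \<Rightarrow> 'a set"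
    and Q :: "nat \<Rightarrow> (nat \<Rightarrow> 'a) \<Rightarrow> 'w measure"
    and Pst :: "nat \<Rightarrow> (nat \<Rightarrow> 'a) \<Rightarrow> 'w \<Rightarrow> 'a measure"
  assumes alpha_pos: "0 < alpha"
    and H: "prob_space H" "sets H = sets M"
    and F: "prob_space F" "sets F = sets M"
    and S: "prob_space S"
    and X_rv: "\<And>i. X i \<in> measurable S M"
    and X_indep: "prob_space.indep_vars S (\<lambda>_. M) X UNIV"
    and X_distr: "\<And>i. distr S M (X i) = F"
    and k: "2 \<le> k"
    and part: "meas_partition M k A"
    and F_pos: "\<And>i. i < k \<Longrightarrow> 0 < measure F (A i)"
    and posterior: "\<And>m x. (\<And>i. x i \<in> space M) \<Longrightarrow>
        is_DP (Q m x) M (Pst m x) (alpha + real m) (post_base M alpha H x m)"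
  shows "AE s in S.
     (let x = (\<lambda>i. X i s);
          D = (\<lambda>m w. chi_stat (alpha + real m) k A (Pst m x w) (post_base M alpha H x m));
          K = (\<lambda>m w. 2 * (alpha + real m) * KL_part k A (Pst m x w) (post_base M alpha H x m))
      in weak_conv_m (\<lambda>m. distr (Q m x) borel (D m)) (chi_sq (real k - 1))
       \<and> conv_prob_zero (\<lambda>m. Q m x) (\<lambda>m w. K m w - D m w)
       \<and> weak_conv_m (\<lambda>m. distr (Q m x) borel (K m)) (chi_sq (real k - 1)))"
proof -
  interpret S: prob_space S by (rule S)
  have A: "A i \<in> sets M" if "i < k" for i
    using part that by (simp add: meas_partition_def)
  \<comment> \<open>One null set serves all finitely many cells and all countably many starting
    indices.\<close>
  have "AE s in S. \<forall>i\<in>{..<k}. \<forall>n. \<exists>j\<ge>n. X j s \<in> A i"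
    by (intro AE_finite_allI finite_lessThan AE_all_countable[THEN iffD2] allI
        S.AE_iid_visits[OF X_rv X_indep X_distr] A F_pos) auto
  then show ?thesis
    using AE_space
  proof eventually_elim
    case (elim s)
    define x where "x = (\<lambda>i. X i s)"
    have x: "x i \<in> space M" for i
      using measurable_space[OF X_rv elim(2)] by (simp add: x_def)
    let ?H = "\<lambda>m. post_base M alpha H x m"
    \<comment> \<open>The Dirichlet parameters of the cells. The factor
      \<open>alpha + real m\<close> cancels the denominator of the posterior base, so they are prior
      mass plus visit count and diverge together with the count.\<close>
    define b where "b m i = (alpha + real m) * measure (?H m) (A i)" for m i
    have a0: "0 < alpha + real m" for m using alpha_pos by simp
    have b_eq: "b m i = alpha * measure H (A i) + (\<Sum>j<m. indicator (A i) (x j))" if "i < k" for m i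
      using a0[of m] by (simp add: b_def measure_post_base[OF H alpha_pos A[OF that]])
    note two_le_k = k
    interpret diverging_weights k b
    proof
      show "0 < k" using k by simp
      fix i assume i: "i < k"
      have "filterlim (\<lambda>m. \<Sum>j<m. indicator (A i) (x j) :: real) at_top sequentially"
        using elim(1) i by (intro filterlim_count_at_top) (simp add: x_def)
      then show "filterlim (\<lambda>m. b m i) at_top sequentially"
        by (rule filterlim_at_top_mono) (use alpha_pos in \<open>simp add: b_eq[OF i]\<close>)
    qed
    have total: "(\<Sum>i<k. b m i) = alpha + real m" for m
    proof -
      interpret P: prob_space "?H m" by (rule prob_space_post_base[OF H alpha_pos x])
      have "(\<Sum>i<k. measure (?H m) (A i)) = measure (?H m) (\<Union>i<k. A i)"
        using part by (intro P.finite_measure_finite_Union[symmetric]) (auto simp: meas_partition_def)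
      also have "(\<Union>i<k. A i) = space (?H m)"
        using part by (simp add: meas_partition_def post_base_def)
      finally show ?thesis
        by (simp add: b_def sum_distrib_left[symmetric] P.prob_space)
    qed
    have ratio: "b m i / (alpha + real m) = measure (?H m) (A i)" for m i
      using a0[of m] by (simp add: b_def)
    define V where "V m w = (\<lambda>i\<in>{..<k}. measure (Pst m x w) (A i))" for m w
    have DP: "is_DP (Q m x) M (Pst m x) (alpha + real m) (?H m)" for m
      by (rule posterior) (rule x)
    have V: "V m \<in> measurable (Q m x) (PiM {..<k} (\<lambda>_. borel))" for m
    proof -
      have "Pst m x \<in> measurable (Q m x) (subprob_algebra M)"
        using DP[of m] by (auto simp: is_DP_def intro: measurable_prob_algebraD)
      then show ?thesis
        unfolding V_def
        by (intro measurable_restrict measurable_compose[OF _ measurable_measure_subprob_algebra]) (auto intro: A)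
    qed
    have law: "distr (Q m x) (PiM {..<k} (\<lambda>_. borel)) (V m) = dirichlet k (b m)" for m
      using DP[of m] part unfolding is_DP_def V_def[abs_def] b_def[abs_def] by blast
    have chi: "chi_form k (b m) (V m w) = chi_stat (alpha + real m) k A (Pst m x w) (?H m)" for m w
      unfolding chi_form_def Let_def total ratio chi_stat_def by (simp add: V_def)
    have KL: "KL_form k (b m) (V m w) = 2 * (alpha + real m) * KL_part k A (Pst m x w) (?H m)" for m w
      unfolding KL_form_def Let_def total ratio KL_part_def by (simp add: V_def)
    show ?case
      using dirichlet_chi_square_limits[OF two_le_k V law] unfolding chi KL Let_def x_def[symmetric] by blast
  qed
qed

end
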